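(* Let $m\ge 1$, let $\mathcal{G}$ be either $\mathbb{Z}^m$ or a dense subset of $\mathbb{R}^m$, and let $f\in\mathcal{G}AA(\mathbb{R}^m,\mathbb{R})\cap\overline{D(\Delta)}$. Then the heat equation $$\partial_t u(t,x)=\Delta u(t,x),\quad t>0,\ x\in\mathbb{R}^m,\qquad u(0,x)=f(x),\quad x\in\mathbb{R}^m,$$ admits a unique solution $u$ such that, for each $t>0$, $u(t,\cdot)\in\mathcal{K}AA(\mathbb{R}^m,\mathbb{R})$.
   Context: For a non-empty set $\mathcal{G}\subset\mathbb{R}^m$, a continuous function $f:\mathbb{R}^m\to\mathbb{R}$ belongs to $\mathcal{G}AA(\mathbb{R}^m,\mathbb{R})$ if for every sequence $(\mathbf{b}_k)$ of elements of $\mathcal{G}$ there exist a subsequence $(\mathbf{b}_{k_l})$ and a function $f^*:\mathbb{R}^m\to\mathbb{R}$ such that, for every $\mathbf{t}\in\mathbb{R}^m$, $\lim_{l}f(\mathbf{t}+\mathbf{b}_{k_l})=f^*(\mathbf{t})$ and $\lim_{l}f^*(\mathbf{t}-\mathbf{b}_{k_l})=f(\mathbf{t})$. $\mathcal{K}AA(\mathbb{R}^m,\mathbb{R})$ is the space of compact almost automorphic functions: continuous $g:\mathbb{R}^m\to\mathbb{R}$ such that for every sequence $(\mathbf{b}_k)$ in $\mathbb{R}^m$ there exist a subsequence $(\mathbf{b}_{k_l})$ and a function $g^*:\mathbb{R}^m\to\mathbb{R}$ with $g(\cdot+\mathbf{b}_{k_l})\to g^*$ and $g^*(\cdot-\mathbf{b}_{k_l})\to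 g$ uniformly on compact subsets of $\mathbb{R}^m$. $BC(\mathbb{R}^m,\mathbb{R})$ (resp. $BUC(\mathbb{R}^m,\mathbb{R})$) is the space of bounded continuous (resp. bounded uniformly continuous) functions with the supremum norm. $\Delta$ is the Laplace operator in the space variable $x$; its maximal domain in $Z=BC(\mathbb{R}^m,\mathbb{R})$ or $Z=BUC(\mathbb{R}^m,\mathbb{R})$ is $D(\Delta)=\{v\in Z:\Delta v\text{ exists in }Z\}$ ($\Delta v$ taken in the sense of distributions), and $\overline{D(\Delta)}$ is its closure in $Z$. Solution: for $f\in BC(\mathbb{R}^m,\mathbb{R})\cap\overline{D(\Delta)}$, a solution of the heat equation is a function $u:[0,+\infty)\times\mathbb{R}^m\to\mathbb{R}$ such that $u\in C^1((0,+\infty),BC(\mathbb{R}^m,\mathbb{R}))$, $u(t,\cdot)\in D(\Delta)$ for all $t>0$, and $u$ satisfies the heat equation with its initial condition pointwise. In particular, if $f\in BUC(\mathbb{R}^m,\mathbb{R})\cap\overline{D(\Delta)}$, the solution is required to satisfy $u\in C([0,+\infty),BC(\mathbb{R}^m,\mathbb{R}))\cap C^1((0,+\infty),BC(\mathbb{R}^m,\mathbb{R}))$, $u(t,\cdot)\in D(\Delta)$ for all $t>0$, and the heat equation with its initial condition pointwise. *)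

theory Defs
  imports "HOL-Analysis.Analysis"
begin

section \<open>Almost automorphic functions\<close>

definition GAA :: "(real^'n) set \<Rightarrow> (real^'n \<Rightarrow> real) set" where
  "GAA G = {f. continuous_on UNIV f \<and>
     (\<forall>b :: nat \<Rightarrow> real^'n. (\<forall>k. b k \<in> G) \<longrightarrow>
        (\<exists>(r :: nat \<Rightarrow> nat) (f' :: real^'n \<Rightarrow> real). strict_mono r \<and>
           (\<forall>t. (\<lambda>l. f (t + b (r l))) \<longlonglongrightarrow> f' t) \<and>
           (\<forall>t. (\<lambda>l. f' (t - b (r l))) \<longlonglongrightarrow> f t)))}"

definition KAA :: "(real^'n \<Rightarrow> real) set" where
  "KAA = {g. continuous_on UNIV g \<and>
     (\<forall>b :: nat \<Rightarrow> real^'n.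
        \<exists>(r :: nat \<Rightarrow> nat) (g' :: real^'n \<Rightarrow> real). strict_mono r \<and>
           (\<forall>K. compact K \<longrightarrow>
              uniform_limit K (\<lambda>l t. g (t + b (r l))) g' sequentially \<and>
              uniform_limit K (\<lambda>l t. g' (t - b (r l))) g sequentially))}"

definition integer_lattice :: "(real^'n) set" where
  "integer_lattice = {x. \<forall>i. x $ i \<in> \<int>}"


section \<open>The Laplace operator in the sense of distributions\<close>

definition partial :: "'n \<Rightarrow> (real^'n \<Rightarrow> real) \<Rightarrow> real^'n \<Rightarrow> real" where
  "partial i f x = frechet_derivative f (at x) (axis i 1)"

primrec Ck :: "nat \<Rightarrow> (real^'n \<Rightarrow> real) \<Rightarrow> bool" where
  "Ck 0 f \<longleftrightarrow> continuous_on UNIV f"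
| "Ck (Suc k) f \<longleftrightarrow> (\<forall>x. f differentiable (at x)) \<and> (\<forall>i. Ck k (partial i f))"

definition test_functions :: "(real^'n \<Rightarrow> real) set" where
  "test_functions = {\<phi>. (\<forall>k. Ck k \<phi>) \<and> compact (closure {x. \<phi> x \<noteq> 0})}"

definition classical_laplacian :: "(real^'n \<Rightarrow> real) \<Rightarrow> real^'n \<Rightarrow> real" where
  "classical_laplacian \<phi> x = (\<Sum>i\<in>UNIV. partial i (partial i \<phi>) x)"

definition has_laplacian :: "((real^'n) \<Rightarrow>\<^sub>C real) \<Rightarrow> ((real^'n) \<Rightarrow>\<^sub>C real) \<Rightarrow> bool" where
  "has_laplacian v w \<longleftrightarrow>
     (\<forall>\<phi>\<in>test_functions.
        (LINT x|lborel. v x * classical_laplacian \<phi> x) = (LINT x|lborel. w x * \<phi> x))"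

text \<open>The space of bounded continuous functions with the supremum norm is the type
  \<^typ>\<open>(real^'n) \<Rightarrow>\<^sub>C real\<close>; below, \<open>Z\<close> is one of its closed subspaces, either \<^term>\<open>UNIV\<close>
  or \<open>BUC\<close>.\<close>

definition BUC :: "((real^'n) \<Rightarrow>\<^sub>C real) set" where
  "BUC = {v. uniformly_continuous_on UNIV (apply_bcontfun v)}"

definition laplacian_domain :: "((real^'n) \<Rightarrow>\<^sub>C real) set \<Rightarrow> ((real^'n) \<Rightarrow>\<^sub>C real) set" where
  "laplacian_domain Z = {v \<in> Z. \<exists>w\<in>Z. has_laplacian v w}"

definition laplacian_domain_closure :: "((real^'n) \<Rightarrow>\<^sub>C real) set \<Rightarrow> ((real^'n) \<Rightarrow>\<^sub>C real) set" where
  "laplacian_domain_closure Z = Z \<inter> closure (laplacian_domain Z)"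


section \<open>Solutions of the heat equation\<close>

text \<open>Only the values \<open>u t x\<close> with \<open>t \<ge> 0\<close> are meaningful. Every use of \<^const>\<open>Bcontfun\<close> is
  guarded by membership in \<^const>\<open>bcontfun\<close>. In the heat equation \<open>w\<close> is the
  distributional Laplacian of \<open>u t\<close>, which is unique as a continuous function. Continuity
  up to \<open>t = 0\<close> is part of the notion of solution when the initial datum is
  uniformly continuous.\<close>

definition heat_solution ::
  "((real^'n) \<Rightarrow>\<^sub>C real) set \<Rightarrow> ((real^'n) \<Rightarrow>\<^sub>C real) \<Rightarrow> (real \<Rightarrow> real^'n \<Rightarrow> real) \<Rightarrow> bool" where
  "heat_solution Z f u \<longleftrightarrow>
     (\<forall>t>0. u t \<in> bcontfun) \<and>
     (\<lambda>t. Bcontfun (u t)) C1_differentiable_on {0<..} \<and>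
     (\<forall>t>0. Bcontfun (u t) \<in> laplacian_domain Z) \<and>
     (\<forall>t>0. \<exists>w. has_laplacian (Bcontfun (u t)) w \<and>
        (\<forall>x. ((\<lambda>s. u s x) has_real_derivative w x) (at t))) \<and>
     (\<forall>x. u 0 x = f x) \<and>
     (f \<in> BUC \<inter> laplacian_domain_closure Z \<longrightarrow>
        (\<forall>t\<ge>0. u t \<in> bcontfun) \<and> continuous_on {0..} (\<lambda>t. Bcontfun (u t)))"

end

theory Submission
  imports Defs "HOL-Probability.Distributions"
begin

text \<open>
The solution is the convolution of the initial datum with the heat kernel, \<open>u t = K\<^sub>t * f\<close>. Let \<open>T\<^sub>t\<close> denote
convolution with \<open>K\<^sub>t\<close>, as a bounded operator on bounded continuous functions. Since the operator norm of a
convolution is at most the \<open>L\<^sup>1\<close> norm of its kernel, dominated convergence shows that \<open>t \<mapsto> T\<^sub>t\<close> is continuously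
differentiable in operator norm for \<open>t > 0\<close>, with derivative the convolution with
\<open>\<partial>\<^sub>t K\<^sub>t = \<Delta> K\<^sub>t\<close> (\<open>heat_semigroup_has_vector_derivative\<close>), and Fubini's theorem with Green's identity identifies this
derivative with the distributional Laplacian of \<open>T\<^sub>t f\<close> (\<open>has_laplacian_heat_semigroup\<close>).

Everything else rests on one commutation rule: if \<open>\<Delta> v = w\<close> in the sense of distributions, then \<open>\<Delta> K\<^sub>t * v = T\<^sub>t w\<close>
(\<open>heat_semigroup_laplacian\<close>). It is obtained by testing with heat kernels truncated by a smooth cutoff.
It has three consequences. First, \<open>norm (T\<^sub>t v - v) \<le> t * norm w\<close>, so the semigroup is strongly continuous at \<open>0\<close> on the
closure of the domain of the Laplacian. Second, since \<open>T\<^sub>t v\<close> is uniformly continuous, so is every function in this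
closure; the solutions are therefore continuous up to time \<open>0\<close> in the supremum norm
(\<open>laplacian_domain_closure_subset_BUC\<close>). Third, for any solution \<open>U\<close> the curve \<open>s \<mapsto> T\<^bsub>t-s\<^esub> (U s)\<close> has derivative zero
on \<open>(0, t)\<close>, which gives \<open>U t = T\<^sub>t f\<close> and hence uniqueness (\<open>heat_solution_eq_heat_semigroup\<close>).

For almost automorphy, dominated convergence shows that convolution with an integrable kernel preserves the limits
along sequences in \<open>G\<close> (\<open>conv_op_GAA\<close>). For \<open>t > 0\<close> the function \<open>T\<^sub>t f\<close> is moreover uniformly continuous. As every point of
the space is within a fixed compact set of \<open>G\<close>, uniform continuity extends almost automorphy from \<open>G\<close> to arbitrary
sequences of shifts, and equicontinuity of the translates makes the convergence uniform on compact sets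
(\<open>GAA_BUC_imp_KAA\<close>).
\<close>

section \<open>Calculus of smooth functions\<close>

lemma partial_eqI:
  "(f has_derivative f') (at x) \<Longrightarrow> partial i f x = f' (axis i 1)"
  by (simp add: partial_def frechet_derivative_at[symmetric])

lemma Ck_continuous: "Ck k f \<Longrightarrow> continuous_on UNIV f"
  by (cases k) (auto intro!: continuous_at_imp_continuous_on differentiable_imp_continuous_within)

lemma Ck_SucD: "Ck (Suc k) f \<Longrightarrow> Ck k f"
proof (induction k arbitrary: f)
  case 0
  then show ?case using Ck_continuous[of 1 f] by simp
next
  case (Suc k)
  then show ?case by (metis Ck.simps(2))
qed

lemma Ck_const: "Ck k (\<lambda>x. c)"
proof (induction k arbitrary: c)
  case (Suc k)
  have "partial i (\<lambda>x. c) = (\<lambda>x. 0)" for i :: 'a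
    by (rule ext, rule partial_eqI[THEN trans, OF has_derivative_const]) simp
  with Suc show ?case by simp
qed simp

lemma Ck_add: "Ck k f \<Longrightarrow> Ck k g \<Longrightarrow> Ck k (\<lambda>x. f x + g x)"
proof (induction k arbitrary: f g)
  case 0
  then show ?case by (simp add: continuous_on_add)
next
  case (Suc k)
  have "partial i (\<lambda>x. f x + g x) = (\<lambda>x. partial i f x + partial i g x)" for i
  proof
    fix x
    have "((\<lambda>x. f x + g x) has_derivative
       (\<lambda>h. frechet_derivative f (at x) h + frechet_derivative g (at x) h)) (at x)"
      using Suc.prems by (intro has_derivative_add) (auto simp: frechet_derivative_works[symmetric])
    then show "partial i (\<lambda>x. f x + g x) x = partial i f x + partial i g x"
      by (subst partial_eqI) (auto simp: partial_def)
  qed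
  with Suc show ?case by (auto intro!: differentiable_add)
qed

lemma partial_mult:
  assumes "f differentiable (at x)" "g differentiable (at x)"
  shows "partial i (\<lambda>x. f x * g x) x = f x * partial i g x + partial i f x * g x"
proof -
  have "((\<lambda>x. f x * g x) has_derivative
     (\<lambda>h. f x * frechet_derivative g (at x) h + frechet_derivative f (at x) h * g x)) (at x)"
    using assms by (intro has_derivative_mult) (auto simp: frechet_derivative_works[symmetric])
  then show ?thesis
    by (subst partial_eqI) (auto simp: partial_def)
qed

lemma Ck_mult: "Ck k f \<Longrightarrow> Ck k g \<Longrightarrow> Ck k (\<lambda>x. f x * g x)"
proof (induction k arbitrary: f g)
  case 0
  then show ?case by (simp add: continuous_on_mult)
next
  case (Suc k)
  have "partial i (\<lambda>x. f x * g x) = (\<lambda>x. f x * partial i g x + partial i f x * g x)" for i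
    using Suc.prems by (auto intro!: partial_mult)
  moreover have "Ck k f" "Ck k g" using Suc.prems Ck_SucD by blast+
  ultimately show ?case
    using Suc by (auto intro!: differentiable_mult Ck_add)
qed

lemma Ck_component: "Ck k (\<lambda>x. x $ j)"
proof (cases k)
  case (Suc l)
  have d: "((\<lambda>x. x $ j) has_derivative (\<lambda>h. h $ j)) (at x)" for x :: "real^'a"
    by (intro bounded_linear_imp_has_derivative bounded_linear_vec_nth)
  have "partial i (\<lambda>x. x $ j) = (\<lambda>x. if i = j then 1 else 0)" for i
    by (rule ext, subst partial_eqI[OF d]) (simp add: axis_def)
  with d show ?thesis by (auto simp: Suc Ck_const intro: differentiableI)
qed (auto intro: continuous_intros)

lemma Ck_sum: "finite A \<Longrightarrow> (\<And>i. i \<in> A \<Longrightarrow> Ck k (f i)) \<Longrightarrow> Ck k (\<lambda>x. \<Sum>i\<in>A. f i x)"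
  by (induction A rule: finite_induct) (auto intro: Ck_const Ck_add)

text \<open>All derivatives of the outer function are carried along as a sequence, because the chain rule for
\<open>h n\<close> produces \<open>h (Suc n)\<close>; this makes the induction on the order of differentiability go through.\<close>
lemma Ck_compose:
  assumes "\<And>n s. (h n has_real_derivative h (Suc n) s) (at s)" and "Ck k g"
  shows "Ck k (\<lambda>x. h n (g x))"
  using assms(2)
proof (induction k arbitrary: n)
  case 0
  have "continuous_on UNIV (h n)"
    using assms(1) by (meson DERIV_isCont continuous_at_imp_continuous_on)
  with 0 show ?case
    by (auto intro: continuous_on_compose2)
next
  case (Suc k)
  have d: "((\<lambda>x. h n (g x)) has_derivative
       (\<lambda>v. frechet_derivative g (at x) v * h (Suc n) (g x))) (at x)" for x
    using Suc.prems assms(1)[of n "g x"]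
    by (intro has_derivative_compose[of g _ x UNIV "h n", THEN has_derivative_eq_rhs])
       (auto simp: frechet_derivative_works[symmetric] has_field_derivative_def fun_eq_iff)
  have "partial i (\<lambda>x. h n (g x)) = (\<lambda>x. partial i g x * h (Suc n) (g x))" for i
    by (rule ext, subst partial_eqI[OF d]) (simp add: partial_def)
  moreover have "Ck k (\<lambda>x. h (Suc n) (g x))"
    using Suc.IH Suc.prems Ck_SucD by blast
  ultimately show ?case
    using Suc.prems d by (auto intro!: Ck_mult differentiableI)
qed

section \<open>Radial functions\<close>

lemma power2_norm_eq_sum: "(norm (x :: real^'n))\<^sup>2 = (\<Sum>i\<in>UNIV. (x $ i)\<^sup>2)"
  unfolding power2_norm_eq_inner by (simp add: inner_vec_def power2_eq_square)

lemma Ck_norm_square: "Ck k (\<lambda>y. (norm (y - a))\<^sup>2)"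
proof -
  have "Ck k (\<lambda>y. \<Sum>i\<in>UNIV. (y $ i + - (a $ i)) * (y $ i + - (a $ i)))"
    by (intro Ck_sum Ck_mult Ck_add Ck_component Ck_const) auto
  then show ?thesis unfolding power2_norm_eq_sum by (simp add: power2_eq_square)
qed

text \<open>Heat kernel and cutoff are both functions of \<open>(norm (y - a))\<^sup>2\<close>, so all Laplacians in the proof
reduce to two derivatives of a function of one real variable. The square of the norm is used instead of the norm
because it is smooth at the centre.\<close>
lemma has_derivative_radial:
  assumes "\<And>s. (F has_real_derivative F1 s) (at s)"
  shows "((\<lambda>y :: real^'n. F ((norm (y - a))\<^sup>2)) has_derivative
          (\<lambda>h. 2 * (h \<bullet> (y - a)) * F1 ((norm (y - a))\<^sup>2))) (at y)"
proof -
  have "((\<lambda>y :: real^'n. (norm (y - a))\<^sup>2) has_derivative (\<lambda>h. 2 * (h \<bullet> (y - a)))) (at y)"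
    unfolding power2_norm_eq_inner
    by (auto intro!: derivative_eq_intros simp: inner_commute)
  from has_derivative_compose[OF this, of F "(*) (F1 ((norm (y - a))\<^sup>2))"] assms show ?thesis
    by (auto simp: has_field_derivative_def mult_ac)
qed

lemma partial_radial:
  assumes "\<And>s. (F has_real_derivative F1 s) (at s)"
  shows "partial i (\<lambda>y :: real^'n. F ((norm (y - a))\<^sup>2)) =
         (\<lambda>y. 2 * (y $ i - a $ i) * F1 ((norm (y - a))\<^sup>2))"
  by (rule ext, subst partial_eqI[OF has_derivative_radial[OF assms]])
     (auto simp: inner_axis_axis inner_axis' inner_axis)

lemma has_derivative_partial_radial:
  assumes "\<And>s. (F has_real_derivative F1 s) (at s)" "\<And>s. (F1 has_real_derivative F2 s) (at s)"
  shows "(partial i (\<lambda>y :: real^'n. F ((norm (y - a))\<^sup>2)) has_derivative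
          (\<lambda>h. 2 * (y $ i - a $ i) * (2 * (h \<bullet> (y - a)) * F2 ((norm (y - a))\<^sup>2)) +
            2 * h $ i * F1 ((norm (y - a))\<^sup>2))) (at y)"
proof -
  have d: "((\<lambda>y :: real^'n. 2 * (y $ i - a $ i)) has_derivative (\<lambda>h. 2 * h $ i)) (at y)"
    by (auto intro!: derivative_eq_intros bounded_linear_imp_has_derivative bounded_linear_vec_nth)
  show ?thesis
    unfolding partial_radial[OF assms(1)]
    by (rule has_derivative_mult[OF d has_derivative_radial[OF assms(2)]])
qed

lemma partial_partial_radial:
  assumes "\<And>s. (F has_real_derivative F1 s) (at s)" "\<And>s. (F1 has_real_derivative F2 s) (at s)"
  shows "partial i (partial i (\<lambda>y :: real^'n. F ((norm (y - a))\<^sup>2))) y =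
    4 * (y $ i - a $ i)\<^sup>2 * F2 ((norm (y - a))\<^sup>2) + 2 * F1 ((norm (y - a))\<^sup>2)"
  by (subst partial_eqI[OF has_derivative_partial_radial[OF assms]])
     (simp add: inner_axis' power2_eq_square algebra_simps)

lemma classical_laplacian_radial:
  assumes "\<And>s. (F has_real_derivative F1 s) (at s)" "\<And>s. (F1 has_real_derivative F2 s) (at s)"
  shows "classical_laplacian (\<lambda>y :: real^'n. F ((norm (y - a))\<^sup>2)) y =
    4 * (norm (y - a))\<^sup>2 * F2 ((norm (y - a))\<^sup>2) + 2 * real CARD('n) * F1 ((norm (y - a))\<^sup>2)"
proof -
  have "(\<Sum>i\<in>UNIV. 4 * (y $ i - a $ i)\<^sup>2 * c) = 4 * (norm (y - a))\<^sup>2 * c" for c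
    by (simp add: power2_norm_eq_sum sum_distrib_left sum_distrib_right)
  then show ?thesis
    unfolding classical_laplacian_def partial_partial_radial[OF assms] by (simp add: sum.distrib)
qed

section \<open>A smooth cutoff\<close>

text \<open>For \<open>s > 0\<close>, the \<open>n\<close>-th derivative of \<open>exp (-1/s)\<close> is \<open>p\<^sub>n (1/s) exp (-1/s)\<close>; differentiating once more
and using \<open>d/ds (1/s) = -(1/s)\<^sup>2\<close> gives the recursion for \<open>p\<^sub>n\<close>.\<close>
primrec bump_poly :: "nat \<Rightarrow> real poly" where
  "bump_poly 0 = 1"
| "bump_poly (Suc n) = [:0, 0, 1:] * (bump_poly n - pderiv (bump_poly n))"

text \<open>The sequence of all derivatives of the standard smooth function that vanishes exactly on the
nonpositive half-line, in the form that the chain rule for \<^const>\<open>Ck\<close> consumes.\<close>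
definition bump :: "nat \<Rightarrow> real \<Rightarrow> real" where
  "bump n s = (if s \<le> 0 then 0 else poly (bump_poly n) (1 / s) * exp (- (1 / s)))"

lemma poly_times_exp_minus_tendsto_0: "((\<lambda>z::real. poly p z * exp (- z)) \<longlongrightarrow> 0) at_top"
proof -
  have "((\<lambda>z::real. \<Sum>i\<le>degree p. coeff p i * (z ^ i / exp z)) \<longlongrightarrow> (\<Sum>i\<le>degree p. coeff p i * 0)) at_top"
    by (intro tendsto_intros tendsto_power_div_exp_0)
  then show ?thesis
    by (simp add: poly_altdef sum_distrib_right sum_distrib_left exp_minus divide_inverse mult_ac)
qed

lemma bump_has_derivative: "(bump n has_real_derivative bump (Suc n) s) (at s)"
proof -
  consider "s < 0" | "s = 0" | "s > 0" by linarith
  then show ?thesis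
  proof cases
    case 1
    have "((\<lambda>_. 0) has_real_derivative bump (Suc n) s) (at s)"
      using 1 by (simp add: bump_def)
    then show ?thesis
      by (rule has_field_derivative_transform_within_open[of _ _ _ "{..<0}"])
         (use 1 in \<open>auto simp: bump_def\<close>)
  next
    case 3
    have "((\<lambda>s. poly (bump_poly n) (1 / s) * exp (- (1 / s))) has_real_derivative bump (Suc n) s) (at s)"
      using 3 by (auto intro!: derivative_eq_intros poly_DERIV[THEN DERIV_chain2]
                   simp: bump_def field_simps power2_eq_square)
    then show ?thesis
      by (rule has_field_derivative_transform_within_open[of _ _ _ "{0<..}"])
         (use 3 in \<open>auto simp: bump_def\<close>)
  next
    case 2
    have "((\<lambda>h. bump n h / h) \<longlongrightarrow> 0) (at_left 0)"
      by (rule Lim_transform_eventually[OF tendsto_const])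
         (auto simp: eventually_at_filter bump_def)
    moreover have "((\<lambda>h. bump n h / h) \<longlongrightarrow> 0) (at_right 0)"
    proof (rule Lim_transform_eventually)
      show "((\<lambda>h. poly ([:0, 1:] * bump_poly n) (inverse h) * exp (- inverse h)) \<longlongrightarrow> 0) (at_right 0)"
        by (rule filterlim_compose[OF poly_times_exp_minus_tendsto_0 filterlim_inverse_at_top_right])
      show "\<forall>\<^sub>F h in at_right 0. poly ([:0, 1:] * bump_poly n) (inverse h) * exp (- inverse h) = bump n h / h"
        by (auto simp: eventually_at_filter bump_def divide_inverse)
    qed
    ultimately have "((\<lambda>h. bump n h / h) \<longlongrightarrow> 0) (at 0)"
      by (simp add: filterlim_split_at)
    then show ?thesis
      by (simp add: 2 DERIV_def bump_def)
  qed
qed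

text \<open>Bounded only on a half-line because that is all the cutoff needs: it evaluates the derivatives at
\<open>1 - \<rho> (norm (y - x))\<^sup>2 \<le> 1\<close>.\<close>
lemma bump_bounded: "\<exists>B. \<forall>s\<le>1. \<bar>bump n s\<bar> \<le> B"
proof -
  have "continuous_on {0..1} (bump n)"
    by (meson bump_has_derivative DERIV_isCont continuous_at_imp_continuous_on)
  then have "bounded (bump n ` {0..1})"
    by (intro compact_imp_bounded compact_continuous_image) auto
  then obtain B where B: "\<And>s. s \<in> {0..1} \<Longrightarrow> \<bar>bump n s\<bar> \<le> B"
    by (fastforce simp: bounded_iff)
  have "\<bar>bump n s\<bar> \<le> \<bar>B\<bar>" if "s \<le> 1" for s
    using B[of s] that by (cases "s \<le> 0") (auto simp: bump_def)
  then show ?thesis by blast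
qed

section \<open>Integration by parts on Euclidean space\<close>

text \<open>Multiplication by \<open>c\<close> scales Lebesgue measure by \<open>\<bar>c\<bar> ^ DIM('a)\<close>. The instances \<open>c = 1\<close> and \<open>c = -1\<close> give
the two forms of a convolution, and \<open>c = sqrt t\<close> gives the parabolic scaling of the heat kernel.\<close>
lemma lborel_integral_affine:
  fixes f :: "'a::euclidean_space \<Rightarrow> real"
  assumes [measurable]: "f \<in> borel_measurable borel" and c: "c \<noteq> 0"
  shows "(LINT x|lborel. f x) = \<bar>c\<bar> ^ DIM('a) * (LINT x|lborel. f (t + c *\<^sub>R x))"
  by (subst lborel_affine[OF c, of t]) (simp add: integral_density integral_distr)

lemma lborel_integrable_affine:
  fixes f :: "'a::euclidean_space \<Rightarrow> real"
  assumes f: "integrable lborel f" and c: "c \<noteq> 0"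
  shows "integrable lborel (\<lambda>x. f (t + c *\<^sub>R x))"
proof -
  have [measurable]: "f \<in> borel_measurable borel"
    using borel_measurable_integrable[OF f] by simp
  have "integrable (density (distr lborel borel (\<lambda>x. t + c *\<^sub>R x)) (\<lambda>_. \<bar>c\<bar> ^ DIM('a))) f"
    using f lborel_affine[OF c, of t] by simp
  then show ?thesis
    using c by (simp add: integrable_density integrable_distr_eq)
qed

lemma lborel_integral_translate:
  fixes f :: "'a::euclidean_space \<Rightarrow> real"
  assumes "f \<in> borel_measurable borel"
  shows "(LINT x|lborel. f (x + t)) = (LINT x|lborel. f x)"
  using lborel_integral_affine[OF assms, of 1 t] by (simp add: add.commute)

lemma lborel_integral_reflect:
  fixes f :: "'a::euclidean_space \<Rightarrow> real"
  assumes "f \<in> borel_measurable borel"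
  shows "(LINT x|lborel. f (t - x)) = (LINT x|lborel. f x)"
  using lborel_integral_affine[OF assms, of "-1" t] by simp

lemma lborel_integrable_translate:
  fixes f :: "'a::euclidean_space \<Rightarrow> real"
  shows "integrable lborel f \<Longrightarrow> integrable lborel (\<lambda>x. f (x + t))"
  using lborel_integrable_affine[of f 1 t] by (simp add: add.commute)

lemma lborel_integrable_reflect:
  fixes f :: "'a::euclidean_space \<Rightarrow> real"
  shows "integrable lborel f \<Longrightarrow> integrable lborel (\<lambda>x. f (t - x))"
  using lborel_integrable_affine[of f "-1" t] by simp

lemma integrable_continuous_bounded_support:
  fixes f :: "'a::euclidean_space \<Rightarrow> real"
  assumes "continuous_on UNIV f" and "\<And>x. R < norm x \<Longrightarrow> f x = 0"
  shows "integrable lborel f"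
proof -
  have "integrable lborel (\<lambda>x. indicator (cball 0 R) x *\<^sub>R f x)"
    using assms(1) by (intro borel_integrable_compact) (auto intro: continuous_on_subset)
  also have "(\<lambda>x. indicator (cball 0 R) x *\<^sub>R f x) = f"
    using assms(2) by (force simp: indicator_def)
  finally show ?thesis .
qed

lemma has_real_derivative_along_axis:
  assumes "\<And>x. g differentiable (at x)"
  shows "((\<lambda>s. g (x + s *\<^sub>R axis i 1)) has_real_derivative partial i g (x + s *\<^sub>R axis i 1)) (at s)"
proof -
  let ?D = "frechet_derivative g (at (x + s *\<^sub>R axis i 1))"
  have D: "(g has_derivative ?D) (at (x + s *\<^sub>R axis i 1))"
    using assms frechet_derivative_works by blast
  have "((\<lambda>s. g (x + s *\<^sub>R axis i 1)) has_derivative (\<lambda>h. ?D (h *\<^sub>R axis i 1))) (at s)"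
    by (rule has_derivative_compose[where f = "\<lambda>s. x + s *\<^sub>R axis i 1", OF _ D]) (auto intro!: derivative_eq_intros)
  moreover have "?D (h *\<^sub>R axis i 1) = partial i g (x + s *\<^sub>R axis i 1) * h" for h
    using linear_scale[OF has_derivative_linear[OF D], of h "axis i 1"] by (simp add: partial_def)
  ultimately show ?thesis
    by (simp add: has_field_derivative_def)
qed

lemma partial_eq_0_outside:
  assumes "\<And>x. R < norm x \<Longrightarrow> g x = 0" and "R < norm x"
  shows "partial i g x = 0"
proof -
  have "open {y :: real^'n. R < norm y}"
    by (intro open_Collect_less continuous_intros)
  then have "(g has_derivative (\<lambda>h. 0)) (at x)"
    using assms by (intro has_derivative_transform_within_open[OF has_derivative_const[of 0]]) auto
  then show ?thesis by (simp add: partial_eqI)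
qed

text \<open>The integral of every difference quotient of \<open>g\<close> vanishes by translation invariance of Lebesgue
measure, and the difference quotients converge dominatedly to the partial derivative. This replaces
an iterated integration over the coordinate lines.\<close>
lemma integral_partial_eq_0:
  assumes g: "Ck 1 g" and R: "\<And>x. R < norm x \<Longrightarrow> g x = 0"
  shows "(LINT x|lborel. partial i g x) = 0"
proof -
  have diff: "\<And>x. g differentiable (at x)" and cont: "continuous_on UNIV (partial i g)"
    using g by auto
  have contg: "continuous_on UNIV g" by (rule Ck_continuous[OF g])
  have [measurable]: "g \<in> borel_measurable borel"
    by (rule borel_measurable_continuous_onI[OF contg])
  have [measurable]: "partial i g \<in> borel_measurable borel"
    by (rule borel_measurable_continuous_onI[OF cont])
  have R': "partial i g x = 0" if "R < norm x" for x
    by (rule partial_eq_0_outside[of R]) (use R that in auto)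
  have "bounded (partial i g ` cball 0 R)"
    by (intro compact_imp_bounded compact_continuous_image)
       (use cont in \<open>auto intro: continuous_on_subset\<close>)
  then obtain B where B: "\<And>x. x \<in> cball 0 R \<Longrightarrow> \<bar>partial i g x\<bar> \<le> B"
    by (fastforce simp: bounded_iff)
  \<comment> \<open>The absolute value only matters if the ball is empty and \<open>B\<close> arbitrary.\<close>
  have B': "\<bar>partial i g x\<bar> \<le> \<bar>B\<bar>" for x
    using B[of x] R'[of x] by (cases "norm x \<le> R") auto
  define h where "h n = inverse (real (Suc n))" for n
  have h: "0 < h n" "h n \<le> 1" for n
    by (auto simp: h_def divide_simps)
  define s where "s n x = (g (x + h n *\<^sub>R axis i 1) - g x) / h n" for n x
  have int: "integrable lborel (\<lambda>x. indicator (cball 0 (R + 1)) x *\<^sub>R \<bar>B\<bar>)" for x :: "real^'a"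
    by (intro borel_integrable_compact) auto
  have "(\<lambda>n. LINT x|lborel. s n x) \<longlonglongrightarrow> (LINT x|lborel. partial i g x)"
  proof (rule integral_dominated_convergence)
    show "integrable lborel (\<lambda>x::real^'a. indicator (cball 0 (R + 1)) x *\<^sub>R \<bar>B\<bar>)"
      by (rule int)
    show "AE x in lborel. (\<lambda>n. s n x) \<longlonglongrightarrow> partial i g x"
    proof (rule AE_I2)
      fix x
      have "((\<lambda>e. (g (x + e *\<^sub>R axis i 1) - g x) / e) \<longlongrightarrow> partial i g x) (at 0)"
        using has_real_derivative_along_axis[OF diff, of x i 0] by (simp add: DERIV_def)
      moreover have "filterlim h (at 0) sequentially"
        unfolding filterlim_at using h(1) LIMSEQ_inverse_real_of_nat
        by (auto simp: h_def[abs_def] simp flip: of_nat_Suc)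
      ultimately show "(\<lambda>n. s n x) \<longlonglongrightarrow> partial i g x"
        unfolding s_def by (rule filterlim_compose)
    qed
    show "AE x in lborel. norm (s n x) \<le> indicator (cball 0 (R + 1)) x *\<^sub>R \<bar>B\<bar>" for n
    proof (rule AE_I2)
      fix x :: "real^'a"
      show "norm (s n x) \<le> indicator (cball 0 (R + 1)) x *\<^sub>R \<bar>B\<bar>"
      proof (cases "norm x \<le> R + 1")
        case True
        have "\<exists>\<xi>>0. \<xi> < h n \<and> g (x + h n *\<^sub>R axis i 1) - g (x + 0 *\<^sub>R axis i 1) =
            (h n - 0) * partial i g (x + \<xi> *\<^sub>R axis i 1)"
          by (rule MVT2[OF h(1)[of n], of "\<lambda>s. g (x + s *\<^sub>R axis i 1)" "\<lambda>s. partial i g (x + s *\<^sub>R axis i 1)"])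
             (rule has_real_derivative_along_axis[OF diff])
        then obtain \<xi> where "g (x + h n *\<^sub>R axis i 1) - g (x + 0 *\<^sub>R axis i 1) =
            (h n - 0) * partial i g (x + \<xi> *\<^sub>R axis i 1)" by (elim exE conjE)
        then have "s n x = partial i g (x + \<xi> *\<^sub>R axis i 1)"
          unfolding s_def using h(1)[of n] by (metis add_0_right diff_zero nonzero_mult_div_cancel_left order_less_irrefl scaleR_zero_left)
        with True B' show ?thesis by simp
      next
        case False
        \<comment> \<open>The steps have length at most 1, so the quotients vanish outside the ball of radius \<open>R + 1\<close>.\<close>
        have "norm x \<le> norm (x + h n *\<^sub>R axis i 1) + norm (h n *\<^sub>R axis i 1 :: real^'a)"
          using norm_triangle_ineq4[of "x + h n *\<^sub>R axis i 1" "h n *\<^sub>R axis i 1"] by simp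
        then have "R < norm (x + h n *\<^sub>R axis i 1)"
          using False h[of n] by simp
        with False R show ?thesis by (simp add: s_def)
      qed
    qed
  qed (auto simp: s_def)
  moreover have "(LINT x|lborel. s n x) = 0" for n
  proof -
    have "integrable lborel g"
      by (rule integrable_continuous_bounded_support[OF contg R])
    moreover from this have "integrable lborel (\<lambda>x. g (x + h n *\<^sub>R axis i 1))"
      by (rule lborel_integrable_translate)
    ultimately show ?thesis
      using lborel_integral_translate[of g "h n *\<^sub>R axis i 1"] by (simp add: s_def)
  qed
  ultimately show ?thesis
    by (simp add: LIMSEQ_const_iff)
qed

lemma integration_by_parts:
  assumes f: "Ck 1 f" and g: "Ck 1 g" and R: "\<And>x. R < norm x \<Longrightarrow> g x = 0"
  shows "(LINT x|lborel. f x * partial i g x) = - (LINT x|lborel. partial i f x * g x)"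
proof -
  have c: "continuous_on UNIV f" "continuous_on UNIV g"
    "continuous_on UNIV (partial i f)" "continuous_on UNIV (partial i g)"
    using f g Ck_continuous[of 1] by (auto simp del: One_nat_def) (auto simp: One_nat_def)
  have i1: "integrable lborel (\<lambda>x. f x * partial i g x)"
    by (rule integrable_continuous_bounded_support[where R = R])
       (use c R in \<open>auto intro!: continuous_intros partial_eq_0_outside\<close>)
  have i2: "integrable lborel (\<lambda>x. partial i f x * g x)"
    by (rule integrable_continuous_bounded_support[where R = R])
       (use c R in \<open>auto intro!: continuous_intros\<close>)
  have "0 = (LINT x|lborel. partial i (\<lambda>x. f x * g x) x)"
    by (rule integral_partial_eq_0[OF Ck_mult[OF f g], of R, symmetric]) (simp add: R)
  also have "\<dots> = (LINT x|lborel. f x * partial i g x + partial i f x * g x)"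
    using f g by (intro Bochner_Integration.integral_cong) (auto intro!: partial_mult)
  also have "\<dots> = (LINT x|lborel. f x * partial i g x) + (LINT x|lborel. partial i f x * g x)"
    by (rule Bochner_Integration.integral_add[OF i1 i2])
  finally show ?thesis by simp
qed

lemma test_functionE:
  assumes "\<phi> \<in> test_functions"
  obtains R where "\<And>x. R < norm x \<Longrightarrow> \<phi> x = 0"
proof -
  have "bounded {x. \<phi> x \<noteq> 0}"
    using assms by (auto simp: test_functions_def intro: bounded_subset compact_imp_bounded closure_subset)
  then obtain R where "\<And>x. \<phi> x \<noteq> 0 \<Longrightarrow> norm x \<le> R"
    by (auto simp: bounded_iff)
  then show thesis using that by (meson linorder_not_le)
qed

lemma Ck_2_partial: "Ck 2 f \<Longrightarrow> Ck 1 (partial i f)"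
  by (simp add: numeral_2_eq_2)

text \<open>Two integrations by parts; only the test function has to vanish far away, so that \<open>\<psi>\<close> may be the heat kernel.\<close>
lemma green_identity:
  assumes \<psi>: "Ck 2 \<psi>" and \<phi>: "\<phi> \<in> test_functions"
  shows "(LINT x|lborel. \<psi> x * classical_laplacian \<phi> x) = (LINT x|lborel. classical_laplacian \<psi> x * \<phi> x)"
proof -
  obtain R where R: "\<And>x. R < norm x \<Longrightarrow> \<phi> x = 0"
    using test_functionE[OF \<phi>] by blast
  have R': "\<And>x. R < norm x \<Longrightarrow> partial i \<phi> x = 0" for i
    using R partial_eq_0_outside by blast
  have R'': "\<And>x. R < norm x \<Longrightarrow> partial i (partial i \<phi>) x = 0" for i
    using R' partial_eq_0_outside by blast
  have \<phi>2: "Ck 2 \<phi>" and \<phi>1: "Ck 1 \<phi>" and \<psi>1: "Ck 1 \<psi>"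
    using \<phi> \<psi> Ck_SucD[of 1 \<psi>] by (auto simp: test_functions_def numeral_2_eq_2)
  have c: "continuous_on UNIV \<psi>" "continuous_on UNIV \<phi>"
    "continuous_on UNIV (partial i (partial i \<phi>))" "continuous_on UNIV (partial i (partial i \<psi>))" for i
    using \<phi>2 \<psi> \<phi>1 \<psi>1 Ck_continuous[of 1] by (auto simp: numeral_2_eq_2 simp del: One_nat_def)
  have i1: "integrable lborel (\<lambda>x. \<psi> x * partial i (partial i \<phi>) x)" for i
    by (rule integrable_continuous_bounded_support[where R = R])
       (use c R'' in \<open>auto intro!: continuous_intros\<close>)
  have i2: "integrable lborel (\<lambda>x. partial i (partial i \<psi>) x * \<phi> x)" for i
    by (rule integrable_continuous_bounded_support[where R = R])
       (use c R in \<open>auto intro!: continuous_intros\<close>)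
  have "(LINT x|lborel. \<psi> x * partial i (partial i \<phi>) x) =
        (LINT x|lborel. partial i (partial i \<psi>) x * \<phi> x)" for i
    using integration_by_parts[OF \<psi>1 Ck_2_partial[OF \<phi>2] R', of R i i]
      integration_by_parts[OF Ck_2_partial[OF \<psi>] \<phi>1 R, of R i i] by simp
  then show ?thesis
    using i1 i2 by (simp add: classical_laplacian_def sum_distrib_left sum_distrib_right)
qed

section \<open>Convolution operators\<close>

lemma borel_measurable_apply_bcontfun [measurable]:
  "apply_bcontfun (f :: 'a::euclidean_space \<Rightarrow>\<^sub>C real) \<in> borel_measurable borel"
  by (intro borel_measurable_continuous_onI) simp

lemma abs_apply_bcontfun_le: "\<bar>apply_bcontfun (f :: 'a::topological_space \<Rightarrow>\<^sub>C real) x\<bar> \<le> norm f"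
  using norm_bounded[of f x] by simp

lemma integrable_mult_bcontfun:
  fixes k :: "'a::euclidean_space \<Rightarrow> real" and f :: "'a \<Rightarrow>\<^sub>C real"
  assumes k: "integrable lborel k" and [measurable]: "g \<in> borel_measurable borel"
  shows "integrable lborel (\<lambda>y. k y * f (g y))"
proof (rule Bochner_Integration.integrable_bound)
  show "integrable lborel (\<lambda>y. norm f * k y)" using k by simp
  have [measurable]: "k \<in> borel_measurable borel"
    using borel_measurable_integrable[OF k] by simp
  show "(\<lambda>y. k y * f (g y)) \<in> borel_measurable lborel" by measurable
  show "AE y in lborel. norm (k y * f (g y)) \<le> norm (norm f * k y)"
    by (auto simp: abs_mult mult.commute[of "norm f"] intro!: mult_left_mono abs_apply_bcontfun_le)
qed

text \<open>Convolution with an integrable kernel is encoded as an element of the Banach space of bounded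
operators. Statements about the heat semigroup then become statements about one
operator-valued curve, to which the product rule applies.\<close>
definition conv_op :: "('a::euclidean_space \<Rightarrow> real) \<Rightarrow> ('a \<Rightarrow>\<^sub>C real) \<Rightarrow>\<^sub>L ('a \<Rightarrow>\<^sub>C real)" where
  "conv_op k = Blinfun (\<lambda>f :: 'a \<Rightarrow>\<^sub>C real. Bcontfun (\<lambda>x. LINT y|lborel. k y * f (x - y)))"

lemma abs_conv_le:
  fixes k :: "'a::euclidean_space \<Rightarrow> real" and f :: "'a \<Rightarrow>\<^sub>C real"
  assumes k: "integrable lborel k"
  shows "\<bar>LINT y|lborel. k y * f (x - y)\<bar> \<le> (LINT y|lborel. \<bar>k y\<bar>) * norm f"
proof -
  have "\<bar>LINT y|lborel. k y * f (x - y)\<bar> \<le> (LINT y|lborel. \<bar>k y * f (x - y)\<bar>)"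
    by (rule integral_abs_bound)
  also have "\<dots> \<le> (LINT y|lborel. \<bar>k y\<bar> * norm f)"
    using k by (intro integral_mono integrable_abs integrable_mult_bcontfun integrable_mult_left)
       (auto simp: abs_mult intro!: mult_left_mono abs_apply_bcontfun_le)
  finally show ?thesis by simp
qed

lemma conv_in_bcontfun:
  fixes k :: "'a::euclidean_space \<Rightarrow> real" and f :: "'a \<Rightarrow>\<^sub>C real"
  assumes k: "integrable lborel k"
  shows "(\<lambda>x. LINT y|lborel. k y * f (x - y)) \<in> bcontfun"
proof (rule bcontfun_normI)
  have [measurable]: "k \<in> borel_measurable borel"
    using borel_measurable_integrable[OF k] by simp
  show "continuous_on UNIV (\<lambda>x. LINT y|lborel. k y * f (x - y))"
    unfolding continuous_on_sequentially comp_def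
  proof safe
    fix X :: "nat \<Rightarrow> 'a" and a assume X: "X \<longlonglongrightarrow> a"
    show "(\<lambda>n. LINT y|lborel. k y * f (X n - y)) \<longlonglongrightarrow> (LINT y|lborel. k y * f (a - y))"
    proof (rule integral_dominated_convergence)
      show "integrable lborel (\<lambda>y. \<bar>k y\<bar> * norm f)" using k by simp
      show "AE y in lborel. (\<lambda>n. k y * f (X n - y)) \<longlonglongrightarrow> k y * f (a - y)"
        by (intro AE_I2 tendsto_intros continuous_on_tendsto_compose[of UNIV "apply_bcontfun f"] X) auto
    qed (auto simp: abs_mult intro!: mult_left_mono abs_apply_bcontfun_le)
  qed
  show "norm (LINT y|lborel. k y * f (x - y)) \<le> (LINT y|lborel. \<bar>k y\<bar>) * norm f" for x
    using abs_conv_le[OF k] by simp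
qed

text \<open>Legitimises the definition: the defining term is a bounded linear map as soon as the kernel is integrable.\<close>
lemma conv_op_apply_bcontfun:
  assumes k: "integrable lborel k"
  shows "blinfun_apply (conv_op k) f = Bcontfun (\<lambda>x. LINT y|lborel. k y * f (x - y))"
proof -
  define C where "C f = Bcontfun (\<lambda>x. LINT y|lborel. k y * apply_bcontfun f (x - y))" for f
  have C: "C f x = (LINT y|lborel. k y * f (x - y))" for f x
    by (simp add: C_def Bcontfun_inverse[OF conv_in_bcontfun[OF k]])
  note int = integrable_mult_bcontfun[OF k]
  have "bounded_linear C"
  proof (rule bounded_linear_intro)
    show "C (f + g) = C f + C g" for f g
      by (rule bcontfun_eqI) (simp add: C plus_bcontfun.rep_eq distrib_left int)
    show "C (r *\<^sub>R f) = r *\<^sub>R C f" for r f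
      by (rule bcontfun_eqI) (simp add: C mult.left_commute)
    show "norm (C f) \<le> norm f * (LINT y|lborel. \<bar>k y\<bar>)" for f
      by (rule norm_bound) (use abs_conv_le[OF k] in \<open>simp add: C mult.commute\<close>)
  qed
  then show ?thesis
    by (simp add: conv_op_def bounded_linear_Blinfun_apply flip: C_def)
qed

lemma conv_op_apply:
  assumes "integrable lborel k"
  shows "blinfun_apply (conv_op k) f x = (LINT y|lborel. k y * f (x - y))"
  by (simp add: conv_op_apply_bcontfun[OF assms] Bcontfun_inverse[OF conv_in_bcontfun[OF assms]])

lemma conv_op_apply':
  assumes k: "integrable lborel k"
  shows "blinfun_apply (conv_op k) f x = (LINT z|lborel. k (x - z) * f z)"
proof -
  have [measurable]: "k \<in> borel_measurable borel"
    using borel_measurable_integrable[OF k] by simp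
  show ?thesis
    using lborel_integral_reflect[of "\<lambda>y. k y * f (x - y)" x] by (simp add: conv_op_apply[OF k])
qed

lemma norm_conv_op_le:
  assumes k: "integrable lborel k"
  shows "norm (conv_op k) \<le> (LINT y|lborel. \<bar>k y\<bar>)"
proof (rule norm_blinfun_bound)
  fix f :: "'a \<Rightarrow>\<^sub>C real"
  show "norm (blinfun_apply (conv_op k) f) \<le> (LINT y|lborel. \<bar>k y\<bar>) * norm f"
    by (rule norm_bound) (use abs_conv_le[OF k] in \<open>simp add: conv_op_apply[OF k]\<close>)
qed simp

lemma conv_op_diff:
  assumes "integrable lborel k" "integrable lborel l"
  shows "conv_op (\<lambda>y. k y - l y) = conv_op k - conv_op l"
  by (intro blinfun_eqI bcontfun_eqI)
     (simp add: assms conv_op_apply minus_bcontfun.rep_eq blinfun.diff_left left_diff_distrib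
        integrable_mult_bcontfun)

lemma conv_op_scaleR:
  assumes "integrable lborel k"
  shows "conv_op (\<lambda>y. c * k y) = c *\<^sub>R conv_op k"
  by (intro blinfun_eqI bcontfun_eqI)
     (simp add: assms conv_op_apply scaleR_bcontfun.rep_eq blinfun.scaleR_left mult.assoc)

text \<open>The operator norm is at most the \<open>L\<^sup>1\<close> norm of the kernel, so dominated convergence of kernels gives
convergence of operators.\<close>
lemma conv_op_tendsto:
  fixes k :: "nat \<Rightarrow> 'a::euclidean_space \<Rightarrow> real"
  assumes k: "\<And>n. integrable lborel (k n)" and w: "integrable lborel w"
    and lim: "\<And>y. (\<lambda>n. k n y) \<longlonglongrightarrow> l y" and bound: "\<And>n y. \<bar>k n y\<bar> \<le> w y"
  shows "(\<lambda>n. conv_op (k n)) \<longlonglongrightarrow> conv_op l" and "integrable lborel l"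
proof -
  have [measurable]: "k n \<in> borel_measurable borel" for n
    using borel_measurable_integrable[OF k] by simp
  have [measurable]: "l \<in> borel_measurable borel"
    by (rule borel_measurable_LIMSEQ_real[OF lim]) simp
  show l: "integrable lborel l"
    by (rule integrable_dominated_convergence[OF _ _ w, of l k]) (use lim bound in auto)
  have b: "\<bar>l y\<bar> \<le> w y" for y
    using lim bound by (intro tendsto_upperbound[OF tendsto_rabs[OF lim]]) auto
  have "(\<lambda>n. LINT y|lborel. \<bar>k n y - l y\<bar>) \<longlonglongrightarrow> (LINT y::'a|lborel. (0 :: real))"
  proof (rule integral_dominated_convergence)
    show "integrable lborel (\<lambda>y. w y + w y)" using w by simp
    show "AE y in lborel. norm \<bar>k n y - l y\<bar> \<le> w y + w y" for n
    proof (rule AE_I2)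
      fix y
      show "norm \<bar>k n y - l y\<bar> \<le> w y + w y"
        using bound[of n y] b[of y] by simp
    qed
    show "AE y in lborel. (\<lambda>n. \<bar>k n y - l y\<bar>) \<longlonglongrightarrow> 0"
      using lim by (intro AE_I2 tendsto_rabs_zero) (simp add: LIM_zero)
  qed auto
  then have "(\<lambda>n. LINT y|lborel. \<bar>k n y - l y\<bar>) \<longlonglongrightarrow> 0" by simp
  then have "(\<lambda>n. conv_op (k n) - conv_op l) \<longlonglongrightarrow> 0"
  proof (rule Lim_null_comparison[rotated], intro always_eventually allI)
    show "norm (conv_op (k n) - conv_op l) \<le> (LINT y|lborel. \<bar>k n y - l y\<bar>)" for n
      using norm_conv_op_le[of "\<lambda>y. k n y - l y"] k l by (simp add: conv_op_diff)
  qed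
  then show "(\<lambda>n. conv_op (k n)) \<longlonglongrightarrow> conv_op l"
    by (simp add: LIM_zero_iff)
qed

lemma conv_op_tendsto_filter:
  fixes k :: "'b::first_countable_topology \<Rightarrow> 'a::euclidean_space \<Rightarrow> real"
  assumes k: "\<forall>\<^sub>F s in at a. integrable lborel (k s) \<and> (\<forall>y. \<bar>k s y\<bar> \<le> w y)"
    and w: "integrable lborel w" and lim: "\<And>y. ((\<lambda>s. k s y) \<longlongrightarrow> l y) (at a)"
  shows "((\<lambda>s. conv_op (k s)) \<longlongrightarrow> conv_op l) (at a)"
  unfolding tendsto_at_iff_sequentially comp_def
proof safe
  fix X :: "nat \<Rightarrow> 'b" assume X: "\<forall>i. X i \<in> UNIV - {a}" "X \<longlonglongrightarrow> a"
  then have X': "filterlim X (at a) sequentially"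
    by (auto simp: filterlim_at)
  then obtain N where N: "\<And>n. n \<ge> N \<Longrightarrow> integrable lborel (k (X n)) \<and> (\<forall>y. \<bar>k (X n) y\<bar> \<le> w y)"
    using k by (auto simp: filterlim_iff eventually_sequentially)
  have "(\<lambda>n. conv_op (k (X (n + N)))) \<longlonglongrightarrow> conv_op l"
    by (rule conv_op_tendsto(1)[OF _ w])
       (use N in \<open>auto intro!: LIMSEQ_ignore_initial_segment[where k = N] filterlim_compose[OF lim X']\<close>)
  then show "(\<lambda>n. conv_op (k (X n))) \<longlonglongrightarrow> conv_op l"
    by (rule LIMSEQ_offset)
qed

lemma has_vector_derivative_quotientI:
  assumes "((\<lambda>h. (f (t + h) - f t) /\<^sub>R h) \<longlongrightarrow> D) (at 0)"
  shows "(f has_vector_derivative D) (at t)"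
proof -
  have "((\<lambda>h. norm ((f (t + h) - f t) /\<^sub>R h - D)) \<longlongrightarrow> 0) (at 0)"
    using assms by (intro tendsto_norm_zero) (simp add: LIM_zero)
  moreover have "\<forall>\<^sub>F h in at 0. norm ((f (t + h) - f t) /\<^sub>R h - D) = norm (f (t + h) - f t - h *\<^sub>R D) / norm h"
    unfolding eventually_at
  proof (intro exI[of _ 1] conjI ballI impI)
    fix h :: real assume "h \<noteq> 0 \<and> dist h 0 < 1"
    then have "(f (t + h) - f t) /\<^sub>R h - D = (f (t + h) - f t - h *\<^sub>R D) /\<^sub>R h"
      by (simp add: scaleR_diff_right)
    then show "norm ((f (t + h) - f t) /\<^sub>R h - D) = norm (f (t + h) - f t - h *\<^sub>R D) / norm h"
      by (simp add: divide_inverse mult.commute)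
  qed simp
  ultimately have "((\<lambda>h. norm (f (t + h) - f t - h *\<^sub>R D) / norm h) \<longlongrightarrow> 0) (at 0)"
    by (rule Lim_transform_eventually)
  then show ?thesis
    by (simp add: has_vector_derivative_def has_derivative_at bounded_linear_scaleR_left)
qed

text \<open>By the mean value theorem the difference quotients of the kernels are bounded by the same majorant as their
derivatives, so they converge in \<open>L\<^sup>1\<close> and hence in operator norm.\<close>
lemma conv_op_has_vector_derivative:
  fixes k :: "real \<Rightarrow> 'a::euclidean_space \<Rightarrow> real"
  assumes "d > 0"
    and k: "\<And>s. \<bar>s - t\<bar> < d \<Longrightarrow> integrable lborel (k s)"
    and deriv: "\<And>s y. \<bar>s - t\<bar> < d \<Longrightarrow> ((\<lambda>s. k s y) has_real_derivative k' s y) (at s)"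
    and bound: "\<And>s y. \<bar>s - t\<bar> < d \<Longrightarrow> \<bar>k' s y\<bar> \<le> w y"
    and w: "integrable lborel w"
  shows "((\<lambda>s. conv_op (k s)) has_vector_derivative conv_op (k' t)) (at t)"
proof -
  have near: "\<forall>\<^sub>F h in at 0. \<bar>h\<bar> < d \<and> h \<noteq> 0"
    using \<open>d > 0\<close> unfolding eventually_at by (intro exI[of _ d]) auto
  have int: "integrable lborel (\<lambda>y. (k (t + h) y - k t y) / h)" if "\<bar>h\<bar> < d" for h
    using k[of "t + h"] k[of t] that by simp
  \<comment> \<open>The difference quotients are themselves convolution operators, with the quotients of the kernels.\<close>
  have "((\<lambda>h. conv_op (\<lambda>y. (k (t + h) y - k t y) / h)) \<longlongrightarrow> conv_op (k' t)) (at 0)"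
  proof (rule conv_op_tendsto_filter[OF _ w])
    show "((\<lambda>h. (k (t + h) y - k t y) / h) \<longlongrightarrow> k' t y) (at 0)" for y
      using deriv[of t y] \<open>d > 0\<close> by (simp add: DERIV_def)
    have quotient_bound: "\<bar>(k (t + h) y - k t y) / h\<bar> \<le> w y" if h: "\<bar>h\<bar> < d" "h \<noteq> 0" for h y
    proof -
      have "\<exists>\<xi>. \<bar>\<xi> - t\<bar> < d \<and> k (t + h) y - k t y = h * k' \<xi> y"
      proof (cases "h > 0")
        case True
        then obtain \<xi> where "\<xi> > t" "\<xi> < t + h" "k (t + h) y - k t y = (t + h - t) * k' \<xi> y"
          using MVT2[of t "t + h" "\<lambda>s. k s y" "\<lambda>s. k' s y"] deriv h by auto
        with h show ?thesis by (intro exI[of _ \<xi>]) auto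
      next
        case False
        then obtain \<xi> where "\<xi> < t" "\<xi> > t + h" "k t y - k (t + h) y = (t - (t + h)) * k' \<xi> y"
          using MVT2[of "t + h" t "\<lambda>s. k s y" "\<lambda>s. k' s y"] deriv h by auto
        with h show ?thesis by (intro exI[of _ \<xi>]) auto
      qed
      then obtain \<xi> where "\<bar>\<xi> - t\<bar> < d" "k (t + h) y - k t y = h * k' \<xi> y" by blast
      with h bound[of \<xi> y] show ?thesis by simp
    qed
    show "\<forall>\<^sub>F h in at 0. integrable lborel (\<lambda>y. (k (t + h) y - k t y) / h) \<and>
        (\<forall>y. \<bar>(k (t + h) y - k t y) / h\<bar> \<le> w y)"
      using near by eventually_elim (use int quotient_bound in blast)
  qed
  moreover have "\<forall>\<^sub>F h in at 0. conv_op (\<lambda>y. (k (t + h) y - k t y) / h) =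
      (conv_op (k (t + h)) - conv_op (k t)) /\<^sub>R h"
    using near
  proof eventually_elim
    case (elim h)
    then have "conv_op (\<lambda>y. (k (t + h) y - k t y) / h) = conv_op (\<lambda>y. inverse h * (k (t + h) y - k t y))"
      by (simp add: divide_inverse mult.commute)
    also have "\<dots> = (conv_op (k (t + h)) - conv_op (k t)) /\<^sub>R h"
      using k[of "t + h"] k[of t] elim \<open>d > 0\<close>
        conv_op_scaleR[of "\<lambda>y. k (t + h) y - k t y" "inverse h"] by (simp add: conv_op_diff)
    finally show ?case .
  qed
  ultimately have "((\<lambda>h. (conv_op (k (t + h)) - conv_op (k t)) /\<^sub>R h) \<longlongrightarrow> conv_op (k' t)) (at 0)"
    by (rule Lim_transform_eventually)
  then show ?thesis
    by (rule has_vector_derivative_quotientI)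
qed

text \<open>Fubini's theorem: the convolution is moved onto the test function.\<close>
lemma conv_op_adjoint:
  fixes k \<psi> :: "'a::euclidean_space \<Rightarrow> real"
  assumes k: "integrable lborel k" and \<psi>: "integrable lborel \<psi>"
  shows "(LINT x|lborel. blinfun_apply (conv_op k) f x * \<psi> x) =
         (LINT z|lborel. f z * (LINT x|lborel. k (x - z) * \<psi> x))"
proof -
  have [measurable]: "k \<in> borel_measurable borel" "\<psi> \<in> borel_measurable borel"
    using borel_measurable_integrable[OF k] borel_measurable_integrable[OF \<psi>] by simp_all
  have kx: "integrable lborel (\<lambda>z. k (x - z))" for x
    using lborel_integrable_reflect[OF k] .
  have "integrable (lborel \<Otimes>\<^sub>M lborel) (\<lambda>(x, z). k (x - z) * f z * \<psi> x)"
  proof (rule lborel_pair.Fubini_integrable)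
    show "AE x in lborel. integrable lborel (\<lambda>z. case (x, z) of (x, z) \<Rightarrow> k (x - z) * f z * \<psi> x)"
      using integrable_mult_bcontfun[OF kx, of "\<lambda>x. x"] by simp
    show "integrable lborel (\<lambda>x. LINT z|lborel. norm (case (x, z) of (x, z) \<Rightarrow> k (x - z) * f z * \<psi> x))"
    proof (rule Bochner_Integration.integrable_bound)
      show "integrable lborel (\<lambda>x. (LINT y|lborel. \<bar>k y\<bar>) * norm f * \<psi> x)" using \<psi> by simp
      show "AE x in lborel. norm (LINT z|lborel. norm (case (x, z) of (x, z) \<Rightarrow> k (x - z) * f z * \<psi> x))
          \<le> norm ((LINT y|lborel. \<bar>k y\<bar>) * norm f * \<psi> x)"
      proof (rule AE_I2)
        fix x
        have "(LINT z|lborel. \<bar>k (x - z) * f z\<bar>) \<le> (LINT z|lborel. \<bar>k (x - z)\<bar> * norm f)"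
        proof (rule integral_mono)
          show "integrable lborel (\<lambda>z. \<bar>k (x - z) * f z\<bar>)"
            using integrable_mult_bcontfun[OF kx, of "\<lambda>x. x"] by (intro integrable_abs) simp
        qed (use kx in \<open>auto simp: abs_mult intro!: mult_left_mono abs_apply_bcontfun_le\<close>)
        also have "\<dots> = (LINT y|lborel. \<bar>k y\<bar>) * norm f"
          using lborel_integral_reflect[of "\<lambda>y. \<bar>k y\<bar>" x] by simp
        finally show "norm (LINT z|lborel. norm (case (x, z) of (x, z) \<Rightarrow> k (x - z) * f z * \<psi> x))
          \<le> norm ((LINT y|lborel. \<bar>k y\<bar>) * norm f * \<psi> x)"
          by (simp add: abs_mult mult_right_mono)
      qed
    qed measurable
  qed measurable
  from lborel_pair.Fubini_integral[OF this]
  have "(LINT x|lborel. LINT z|lborel. k (x - z) * f z * \<psi> x) =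
        (LINT z|lborel. LINT x|lborel. k (x - z) * f z * \<psi> x)"
    by simp
  then show ?thesis
    by (simp add: conv_op_apply'[OF k] mult_ac flip: Bochner_Integration.integral_mult_right_zero)
qed

section \<open>Uniform continuity of convolutions\<close>

lemma BUC_iff: "v \<in> BUC \<longleftrightarrow> (\<forall>e>0. \<exists>d>0. \<forall>y x. dist x y < d \<longrightarrow> \<bar>v x - v y\<bar> < e)"
  by (simp add: BUC_def uniformly_continuous_on_def dist_real_def)

lemma closed_BUC: "closed (BUC :: ((real^'n) \<Rightarrow>\<^sub>C real) set)"
  unfolding closed_sequential_limits
proof (intro allI impI, elim conjE)
  fix v :: "nat \<Rightarrow> (real^'n) \<Rightarrow>\<^sub>C real" and l
  assume v: "\<forall>n. v n \<in> BUC" and lim: "v \<longlonglongrightarrow> l"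
  show "l \<in> BUC"
    unfolding BUC_iff
  proof (intro allI impI)
    fix e :: real assume "e > 0"
    then obtain n where n: "dist (v n) l < e / 3"
      using metric_LIMSEQ_D[OF lim, of "e / 3"] by auto
    obtain d where d: "d > 0" "\<And>x y. dist x y < d \<Longrightarrow> \<bar>v n x - v n y\<bar> < e / 3"
      using v[rule_format, of n, unfolded BUC_iff, rule_format, of "e / 3"] \<open>e > 0\<close> by auto
    have "\<bar>v n x - l x\<bar> < e / 3" for x
      using dist_fun_lt_imp_dist_val_lt[OF n, of x] by (simp add: dist_real_def)
    note close = this
    have "\<bar>l x - l y\<bar> < e" if "dist x y < d" for x y
      using close[of x] close[of y] d(2)[OF that] by linarith
    with d(1) show "\<exists>d>0. \<forall>y x. dist x y < d \<longrightarrow> \<bar>l x - l y\<bar> < e" by blast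
  qed
qed

text \<open>A convolution inherits the modulus of continuity of the function, up to the \<open>L\<^sup>1\<close> norm of the kernel.\<close>
lemma conv_op_BUC:
  assumes k: "integrable lborel k" and f: "f \<in> BUC"
  shows "blinfun_apply (conv_op k) f \<in> BUC"
  unfolding BUC_iff
proof (intro allI impI)
  fix e :: real assume "e > 0"
  define c where "c = (LINT y|lborel. \<bar>k y\<bar>)"
  have "c \<ge> 0" by (simp add: c_def)
  obtain d where d: "d > 0" "\<And>x y. dist x y < d \<Longrightarrow> \<bar>f x - f y\<bar> < e / (c + 1)"
    using f[unfolded BUC_iff, rule_format, of "e / (c + 1)"] \<open>e > 0\<close> \<open>c \<ge> 0\<close> by auto
  have "\<bar>blinfun_apply (conv_op k) f x - blinfun_apply (conv_op k) f y\<bar> < e" if "dist x y < d" for x y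
  proof -
    have i: "integrable lborel (\<lambda>z. k z * f (x - z))" for x
      by (rule integrable_mult_bcontfun[OF k]) simp
    have "\<bar>blinfun_apply (conv_op k) f x - blinfun_apply (conv_op k) f y\<bar> =
        \<bar>LINT z|lborel. k z * f (x - z) - k z * f (y - z)\<bar>"
      by (simp add: conv_op_apply[OF k] i)
    also have "\<dots> \<le> (LINT z|lborel. \<bar>k z * f (x - z) - k z * f (y - z)\<bar>)"
      by (rule integral_abs_bound)
    also have "\<dots> \<le> (LINT z|lborel. \<bar>k z\<bar> * (e / (c + 1)))"
    proof (rule integral_mono)
      fix z
      have "\<bar>f (x - z) - f (y - z)\<bar> \<le> e / (c + 1)"
        using d(2)[of "x - z" "y - z"] that by (simp add: dist_norm less_imp_le)
      then have "\<bar>k z\<bar> * \<bar>f (x - z) - f (y - z)\<bar> \<le> \<bar>k z\<bar> * (e / (c + 1))"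
        by (rule mult_left_mono) simp
      then show "\<bar>k z * f (x - z) - k z * f (y - z)\<bar> \<le> \<bar>k z\<bar> * (e / (c + 1))"
        by (simp only: abs_mult flip: right_diff_distrib)
    qed (use i k in auto)
    also have "\<dots> = e * (c / (c + 1))" by (simp add: c_def)
    also have "\<dots> < e" using \<open>e > 0\<close> \<open>c \<ge> 0\<close> by (simp add: field_simps)
    finally show ?thesis .
  qed
  with d(1) show "\<exists>d>0. \<forall>y x. dist x y < d \<longrightarrow>
      \<bar>blinfun_apply (conv_op k) f x - blinfun_apply (conv_op k) f y\<bar> < e" by blast
qed

text \<open>A convolution also inherits uniform continuity from the kernel: moving \<open>x\<close> translates the kernel, and
translations of this kernel are continuous in \<open>L\<^sup>1\<close>.\<close>
lemma conv_op_smoothing_BUC: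
  assumes k: "integrable lborel k" and lim: "((\<lambda>h. LINT y|lborel. \<bar>k (y + h) - k y\<bar>) \<longlongrightarrow> 0) (at 0)"
  shows "blinfun_apply (conv_op k) f \<in> BUC"
  unfolding BUC_iff
proof (intro allI impI)
  fix e :: real assume "e > 0"
  have e': "e / (norm f + 1) > 0" using \<open>e > 0\<close> by (simp add: add_nonneg_pos)
  obtain d where d: "d > 0"
    "\<And>h. h \<noteq> 0 \<Longrightarrow> norm h < d \<Longrightarrow> (LINT y|lborel. \<bar>k (y + h) - k y\<bar>) < e / (norm f + 1)"
    using tendstoD[OF lim e'] by (auto simp: eventually_at dist_norm)
  have "\<bar>blinfun_apply (conv_op k) f x - blinfun_apply (conv_op k) f y\<bar> < e" if xy: "dist x y < d" for x y
  proof -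
    have kx: "integrable lborel (\<lambda>z. k (x - z))" for x
      using lborel_integrable_reflect[OF k] .
    have [measurable]: "k \<in> borel_measurable borel"
      using borel_measurable_integrable[OF k] by simp
    have i: "integrable lborel (\<lambda>z. k (x - z) * f z)" for x
      using integrable_mult_bcontfun[OF kx, of "\<lambda>x. x"] by simp
    have "\<bar>blinfun_apply (conv_op k) f x - blinfun_apply (conv_op k) f y\<bar> =
        \<bar>LINT z|lborel. k (x - z) * f z - k (y - z) * f z\<bar>"
      by (simp add: conv_op_apply'[OF k] i)
    also have "\<dots> \<le> (LINT z|lborel. \<bar>k (x - z) * f z - k (y - z) * f z\<bar>)"
      by (rule integral_abs_bound)
    also have "\<dots> \<le> (LINT z|lborel. \<bar>k (x - z) - k (y - z)\<bar> * norm f)"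
    proof (rule integral_mono)
      show "integrable lborel (\<lambda>z. \<bar>k (x - z) * f z - k (y - z) * f z\<bar>)"
        using i by (intro integrable_abs Bochner_Integration.integrable_diff)
      show "integrable lborel (\<lambda>z. \<bar>k (x - z) - k (y - z)\<bar> * norm f)"
        using kx by simp
    qed (auto simp: abs_mult simp flip: left_diff_distrib
           intro!: mult_left_mono abs_apply_bcontfun_le)
    also have "\<dots> = (LINT z|lborel. \<bar>k (z + (x - y)) - k z\<bar>) * norm f"
      using lborel_integral_reflect[of "\<lambda>z. \<bar>k (z + (x - y)) - k z\<bar>" y] by (simp add: algebra_simps)
    also have "\<dots> \<le> e / (norm f + 1) * norm f"
    proof (rule mult_right_mono)
      show "(LINT z|lborel. \<bar>k (z + (x - y)) - k z\<bar>) \<le> e / (norm f + 1)"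
        using d(2)[of "x - y"] xy e' by (cases "x = y") (auto simp: dist_norm less_imp_le)
    qed simp
    also have "\<dots> = e * (norm f / (norm f + 1))" by simp
    also have "\<dots> < e * 1"
      using \<open>e > 0\<close> by (intro mult_strict_left_mono) (auto simp: divide_less_eq add_nonneg_pos)
    also have "\<dots> = e" by simp
    finally show ?thesis .
  qed
  with d(1) show "\<exists>d>0. \<forall>y x. dist x y < d \<longrightarrow>
      \<bar>blinfun_apply (conv_op k) f x - blinfun_apply (conv_op k) f y\<bar> < e" by blast
qed

section \<open>The heat kernel\<close>

text \<open>The Gaussian of total mass one and variance \<open>2 t\<close> in every coordinate.\<close>
definition heat_kernel :: "real \<Rightarrow> real^'n \<Rightarrow> real" where
  "heat_kernel t x = (4 * pi * t) powr (- (CARD('n) / 2)) * exp (- (norm x)\<^sup>2 / (4 * t))"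

text \<open>At once the time derivative and the Laplacian of the heat kernel; both facts are shown below.\<close>
definition heat_kernel_dt :: "real \<Rightarrow> real^'n \<Rightarrow> real" where
  "heat_kernel_dt t x = ((norm x)\<^sup>2 / (4 * t\<^sup>2) - CARD('n) / (2 * t)) * heat_kernel t x"

lemma heat_kernel_nonneg: "0 \<le> heat_kernel t x"
  by (simp add: heat_kernel_def)

lemma heat_kernel_measurable [measurable]: "heat_kernel t \<in> borel_measurable borel"
  unfolding heat_kernel_def[abs_def] by measurable

lemma heat_kernel_dt_measurable [measurable]: "heat_kernel_dt t \<in> borel_measurable borel"
  unfolding heat_kernel_dt_def[abs_def] by measurable

lemma heat_kernel_minus: "heat_kernel t (x - y) = heat_kernel t (y - x)"
  by (simp add: heat_kernel_def norm_minus_commute)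

text \<open>The heat kernel is a product of one-dimensional normal densities, so its mass is a product of ones.\<close>
lemma heat_kernel_eq_prod:
  fixes x :: "real^'n"
  assumes t: "t > 0"
  shows "heat_kernel t x = (\<Prod>i\<in>UNIV. normal_density 0 (sqrt (2 * t)) (x $ i))"
proof -
  have "normal_density 0 (sqrt (2 * t)) s = exp (- (s\<^sup>2 / (4 * t))) * (4 * pi * t) powr - (1 / 2)" for s
    using t by (simp add: normal_density_def powr_minus_divide powr_half_sqrt mult_ac)
  then have "(\<Prod>i\<in>UNIV. normal_density 0 (sqrt (2 * t)) (x $ i)) =
      exp (\<Sum>i\<in>UNIV. - ((x $ i)\<^sup>2 / (4 * t))) * ((4 * pi * t) powr - (1 / 2)) ^ CARD('n)"
    by (simp add: prod.distrib exp_sum)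
  also have "(\<Sum>i\<in>UNIV. - ((x $ i)\<^sup>2 / (4 * t))) = - (norm x)\<^sup>2 / (4 * t)"
    by (simp add: power2_norm_eq_sum sum_negf sum_divide_distrib)
  also have "((4 * pi * t) powr - (1 / 2)) ^ CARD('n) = (4 * pi * t) powr (- (CARD('n) / 2))"
    using t by (simp add: powr_power)
  finally show ?thesis by (simp add: heat_kernel_def)
qed

lemma prod_Basis_vec: "(\<Prod>b\<in>Basis. f ((x :: real^'n) \<bullet> b)) = (\<Prod>i\<in>UNIV. f (x $ i))"
proof -
  have "Basis = range (\<lambda>i. axis i (1 :: real) :: real^'n)"
    by (auto simp: Basis_vec_def)
  then have "(\<Prod>b\<in>Basis. f (x \<bullet> b)) = (\<Prod>b\<in>range (\<lambda>i. axis i (1 :: real) :: real^'n). f (x \<bullet> b))"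
    by (rule arg_cong)
  also have "\<dots> = (\<Prod>i\<in>UNIV. f (x $ i))"
    by (subst prod.reindex) (auto simp: inj_on_def axis_eq_axis inner_axis)
  finally show ?thesis .
qed

lemma nn_integral_heat_kernel:
  assumes t: "t > 0"
  shows "(\<integral>\<^sup>+x. ennreal (heat_kernel t (x :: real^'n)) \<partial>lborel) = 1"
proof -
  let ?d = "normal_density 0 (sqrt (2 * t))"
  have one: "(\<integral>\<^sup>+s. ennreal (?d s) \<partial>lborel) = 1"
    using t by (subst nn_integral_eq_integral) auto
  have "(\<integral>\<^sup>+x. ennreal (heat_kernel t (x :: real^'n)) \<partial>lborel) =
        (\<integral>\<^sup>+x. (\<Prod>b\<in>Basis. ennreal (?d ((x :: real^'n) \<bullet> b))) \<partial>lborel)"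
    by (simp add: heat_kernel_eq_prod[OF t] prod_ennreal flip: prod_Basis_vec)
  also have "\<dots> = (\<Prod>b\<in>(Basis :: (real^'n) set). \<integral>\<^sup>+s. ennreal (?d s) \<partial>lborel)"
    by (rule nn_integral_lborel_prod) auto
  finally show ?thesis by (simp add: one)
qed

lemma integrable_heat_kernel: "t > 0 \<Longrightarrow> integrable lborel (heat_kernel t)"
  by (intro integrableI_nonneg) (auto simp: heat_kernel_nonneg nn_integral_heat_kernel)

lemma integral_heat_kernel: "t > 0 \<Longrightarrow> (LINT x|lborel. heat_kernel t x) = 1"
  by (subst integral_eq_nn_integral) (auto simp: heat_kernel_nonneg nn_integral_heat_kernel)

lemma integrable_gaussian:
  assumes a: "a > 0"
  shows "integrable lborel (\<lambda>x :: real^'n. exp (- (a * (norm x)\<^sup>2)))"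
proof -
  have "integrable lborel (\<lambda>x :: real^'n. (pi / a) powr (CARD('n) / 2) * heat_kernel (1 / (4 * a)) x)"
    using a integrable_heat_kernel[of "1 / (4 * a)"] by simp
  also have "(\<lambda>x :: real^'n. (pi / a) powr (CARD('n) / 2) * heat_kernel (1 / (4 * a)) x) =
      (\<lambda>x. exp (- (a * (norm x)\<^sup>2)))"
    using a by (simp add: heat_kernel_def powr_minus fun_eq_iff mult.commute)
  finally show ?thesis .
qed

text \<open>Half of the Gaussian decay absorbs the quadratic factor, since \<open>u \<le> exp u\<close> for \<open>u = a (norm x)\<^sup>2 / 2\<close>.\<close>
lemma integrable_gaussian_moment:
  assumes a: "a > 0"
  shows "integrable lborel (\<lambda>x :: real^'n. (norm x)\<^sup>2 * exp (- (a * (norm x)\<^sup>2)))"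
proof (rule Bochner_Integration.integrable_bound)
  show "integrable lborel (\<lambda>x :: real^'n. 2 / a * exp (- (a / 2 * (norm x)\<^sup>2)))"
    using a by (intro integrable_mult_right integrable_gaussian) auto
  show "AE x :: real^'n in lborel. norm ((norm x)\<^sup>2 * exp (- (a * (norm x)\<^sup>2))) \<le>
      norm (2 / a * exp (- (a / 2 * (norm x)\<^sup>2)))"
  proof (rule AE_I2)
    fix x :: "real^'n"
    have "a / 2 * (norm x)\<^sup>2 \<le> exp (a / 2 * (norm x)\<^sup>2)"
      using exp_ge_add_one_self[of "a / 2 * (norm x)\<^sup>2"] by linarith
    then have "(norm x)\<^sup>2 \<le> 2 / a * exp (a / 2 * (norm x)\<^sup>2)"
      using a by (simp add: field_simps)
    then have "(norm x)\<^sup>2 * exp (- (a * (norm x)\<^sup>2)) \<le>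
        2 / a * exp (a / 2 * (norm x)\<^sup>2) * exp (- (a * (norm x)\<^sup>2))"
      by (rule mult_right_mono) simp
    also have "\<dots> = 2 / a * exp (- (a / 2 * (norm x)\<^sup>2))"
      by (simp add: mult.assoc flip: exp_add)
    finally show "norm ((norm x)\<^sup>2 * exp (- (a * (norm x)\<^sup>2))) \<le>
      norm (2 / a * exp (- (a / 2 * (norm x)\<^sup>2)))"
      using a by simp
  qed
qed measurable

lemma heat_kernel_has_derivative:
  assumes t: "t > 0"
  shows "((\<lambda>t. heat_kernel t x) has_real_derivative heat_kernel_dt t x) (at t)"
proof -
  have "((\<lambda>t. exp (- (CARD('a) / 2) * ln (4 * pi * t))) has_real_derivative
      - (CARD('a) / 2) / t * exp (- (CARD('a) / 2) * ln (4 * pi * t))) (at t)"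
    using t by (auto intro!: derivative_eq_intros)
  then have "((\<lambda>t. (4 * pi * t) powr (- (CARD('a) / 2))) has_real_derivative
      - (CARD('a) / 2) / t * exp (- (CARD('a) / 2) * ln (4 * pi * t))) (at t)"
    by (rule has_field_derivative_transform_within_open[of _ _ _ "{0<..}"]) (use t in \<open>auto simp: powr_def\<close>)
  moreover have "exp (- (CARD('a) / 2) * ln (4 * pi * t)) = (4 * pi * t) powr (- (CARD('a) / 2))"
    using t by (simp add: powr_def)
  ultimately have powr: "((\<lambda>t. (4 * pi * t) powr (- (CARD('a) / 2))) has_real_derivative
      - (CARD('a) / 2) / t * (4 * pi * t) powr (- (CARD('a) / 2))) (at t)"
    by simp
  have "((\<lambda>t. exp (- (norm x)\<^sup>2 / (4 * t))) has_real_derivative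
      (norm x)\<^sup>2 / (4 * t\<^sup>2) * exp (- (norm x)\<^sup>2 / (4 * t))) (at t)"
    using t by (auto intro!: derivative_eq_intros simp: field_simps power2_eq_square)
  from DERIV_mult[OF powr this] show ?thesis
    by (simp add: heat_kernel_def heat_kernel_dt_def algebra_simps)
qed

lemma heat_kernel_dt_isCont:
  assumes t: "t > 0"
  shows "isCont (\<lambda>t. heat_kernel_dt t x) t"
  unfolding heat_kernel_dt_def heat_kernel_def using t by (intro continuous_intros) auto

text \<open>One integrable function that dominates \<open>heat_kernel_dt s\<close> for all \<open>s\<close> between \<open>t/2\<close> and \<open>3t/2\<close>: each factor
of \<open>heat_kernel_dt\<close> is replaced by a bound on this interval.\<close>
definition heat_majorant :: "real \<Rightarrow> real^'n \<Rightarrow> real" where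
  "heat_majorant t x = ((norm x)\<^sup>2 / t\<^sup>2 + CARD('n) / t) *
     ((2 * pi * t) powr (- (CARD('n) / 2)) * exp (- (1 / (8 * t) * (norm x)\<^sup>2)))"

lemma integrable_heat_majorant:
  assumes t: "t > 0"
  shows "integrable lborel (heat_majorant t :: real^'n \<Rightarrow> real)"
proof -
  let ?e = "\<lambda>x :: real^'n. exp (- (1 / (8 * t) * (norm x)\<^sup>2))"
  have "integrable lborel (\<lambda>x. (2 * pi * t) powr (- (CARD('n) / 2)) / t\<^sup>2 * ((norm x)\<^sup>2 * ?e x) +
      (2 * pi * t) powr (- (CARD('n) / 2)) * (CARD('n) / t) * ?e x)"
    using t by (intro Bochner_Integration.integrable_add integrable_mult_right
        integrable_gaussian integrable_gaussian_moment) auto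
  then show ?thesis
    by (rule back_subst[of "integrable lborel"]) (auto simp: heat_majorant_def fun_eq_iff algebra_simps)
qed

lemma heat_kernel_dt_le_majorant:
  fixes x :: "real^'n"
  assumes s: "\<bar>s - t\<bar> < t / 2"
  shows "\<bar>heat_kernel_dt s x\<bar> \<le> heat_majorant t x"
proof -
  have st: "t / 2 \<le> s" "s \<le> 2 * t" "t > 0" "s > 0" using s by linarith+
  have "(4 * pi * s) powr (- (CARD('n) / 2)) \<le> (2 * pi * t) powr (- (CARD('n) / 2))"
    using st by (intro powr_mono2') auto
  moreover have "exp (- (norm x)\<^sup>2 / (4 * s)) \<le> exp (- (1 / (8 * t) * (norm x)\<^sup>2))"
  proof -
    have "1 / (8 * t) * (norm x)\<^sup>2 \<le> 1 / (4 * s) * (norm x)\<^sup>2"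
      using st by (intro mult_right_mono divide_left_mono) auto
    then show ?thesis by simp
  qed
  ultimately have 1: "heat_kernel s x \<le>
      (2 * pi * t) powr (- (CARD('n) / 2)) * exp (- (1 / (8 * t) * (norm x)\<^sup>2))"
    unfolding heat_kernel_def by (intro mult_mono) auto
  have "(t / 2)\<^sup>2 \<le> s\<^sup>2" using st by (intro power_mono) auto
  then have "(norm x)\<^sup>2 / (4 * s\<^sup>2) \<le> (norm x)\<^sup>2 / t\<^sup>2"
    using st by (intro divide_left_mono) (auto simp: power2_eq_square)
  moreover have "CARD('n) / (2 * s) \<le> CARD('n) / t"
    using st by (intro divide_left_mono) auto
  moreover have "0 \<le> (norm x)\<^sup>2 / (4 * s\<^sup>2)" "0 \<le> CARD('n) / (2 * s)" using st by auto
  ultimately have "\<bar>(norm x)\<^sup>2 / (4 * s\<^sup>2) - CARD('n) / (2 * s)\<bar> \<le> (norm x)\<^sup>2 / t\<^sup>2 + CARD('n) / t"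
    by linarith
  then show ?thesis
    unfolding heat_kernel_dt_def heat_majorant_def abs_mult abs_of_nonneg[OF heat_kernel_nonneg]
    using 1 by (intro mult_mono heat_kernel_nonneg) auto
qed

lemma integrable_heat_kernel_dt:
  assumes t: "t > 0"
  shows "integrable lborel (heat_kernel_dt t)"
proof (rule Bochner_Integration.integrable_bound[OF integrable_heat_majorant[OF t]])
  show "AE x in lborel. norm (heat_kernel_dt t x) \<le> norm (heat_majorant t x)"
    using heat_kernel_dt_le_majorant[of t t] t by (auto intro: order_trans[OF _ abs_ge_self])
qed measurable

lemma Ck_heat_kernel:
  assumes t: "t > 0"
  shows "Ck k (\<lambda>y. heat_kernel t (y - a))"
proof -
  define h where "h n s = (4 * pi * t) powr (- (CARD('a) / 2)) * (- 1 / (4 * t)) ^ n * exp (- s / (4 * t))"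
    for n s
  have "(h n has_real_derivative h (Suc n) s) (at s)" for n s
    unfolding h_def using t by (auto intro!: derivative_eq_intros)
  from Ck_compose[where h = h and n = 0, OF this Ck_norm_square, of k a] show ?thesis
    by (simp add: h_def heat_kernel_def)
qed

lemma classical_laplacian_heat_kernel:
  assumes t: "t > 0"
  shows "classical_laplacian (\<lambda>y. heat_kernel t (y - a)) y = heat_kernel_dt t (y - a)"
proof -
  define h where "h n s = (4 * pi * t) powr (- (CARD('a) / 2)) * (- 1 / (4 * t)) ^ n * exp (- s / (4 * t))"
    for n s
  have h: "(h n has_real_derivative h (Suc n) s) (at s)" for n s
    unfolding h_def using t by (auto intro!: derivative_eq_intros)
  have "(\<lambda>y. heat_kernel t (y - a)) = (\<lambda>y. h 0 ((norm (y - a))\<^sup>2))"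
    by (simp add: h_def heat_kernel_def)
  then show ?thesis
    by (simp add: classical_laplacian_radial[OF h h])
       (simp add: h_def heat_kernel_dt_def heat_kernel_def divide_simps power2_eq_square, simp add: algebra_simps)
qed

text \<open>For shifts of norm at most \<open>B\<close>, the translated kernels have the common majorant
\<open>exp (B\<^sup>2 / (4t)) exp (-(norm y)\<^sup>2 / (8t))\<close>, up to a constant factor, because \<open>(norm y)\<^sup>2 \<le> 2 (norm (y + h))\<^sup>2 + 2 (norm h)\<^sup>2\<close>.\<close>
lemma heat_kernel_L1_translation:
  assumes t: "t > 0"
  shows "((\<lambda>h. LINT y|lborel. \<bar>heat_kernel t (y + h) - heat_kernel t (y :: real^'n)\<bar>) \<longlongrightarrow> 0) (at 0)"
  unfolding tendsto_at_iff_sequentially comp_def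
proof safe
  fix X :: "nat \<Rightarrow> real^'n" assume X: "X \<longlonglongrightarrow> 0"
  obtain B where B: "norm (X n) \<le> B" for n
    using X by (metis convergentI convergent_imp_Bseq BseqE)
  define c where "c = (4 * pi * t) powr (- (CARD('n) / 2))"
  have c: "c \<ge> 0" by (simp add: c_def)
  define g where "g y = c * exp (B\<^sup>2 / (4 * t)) * exp (- (1 / (8 * t) * (norm y)\<^sup>2))" for y :: "real^'n"
  \<comment> \<open>The shifts form a convergent, hence bounded, sequence.\<close>
  have bound: "heat_kernel t (y + h) \<le> g y" if "norm h \<le> B" for y h
  proof -
    have "norm y \<le> norm (y + h) + norm h"
      using norm_triangle_ineq4[of "y + h" h] by simp
    then have "(norm y)\<^sup>2 \<le> (norm (y + h) + norm h)\<^sup>2" by (intro power_mono) auto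
    also have "\<dots> \<le> 2 * (norm (y + h))\<^sup>2 + 2 * (norm h)\<^sup>2"
      using sum_squares_bound[of "norm (y + h)" "norm h"] by (simp add: power2_sum)
    also have "(norm h)\<^sup>2 \<le> B\<^sup>2" using that by (intro power_mono) auto
    finally have "- (norm (y + h))\<^sup>2 \<le> B\<^sup>2 - (norm y)\<^sup>2 / 2" by simp
    then have "- (norm (y + h))\<^sup>2 / (4 * t) \<le> (B\<^sup>2 - (norm y)\<^sup>2 / 2) / (4 * t)"
      using t by (intro divide_right_mono) auto
    also have "\<dots> = B\<^sup>2 / (4 * t) + - (1 / (8 * t) * (norm y)\<^sup>2)"
      by (simp add: diff_divide_distrib)
    finally have "exp (- (norm (y + h))\<^sup>2 / (4 * t)) \<le> exp (B\<^sup>2 / (4 * t)) * exp (- (1 / (8 * t) * (norm y)\<^sup>2))"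
      by (simp flip: exp_add)
    then show ?thesis
      unfolding heat_kernel_def c_def[symmetric] unfolding g_def mult.assoc using c by (intro mult_left_mono)
  qed
  have "B \<ge> 0" using B[of 0] norm_ge_zero order_trans by blast
  have "(\<lambda>n. LINT y|lborel. \<bar>heat_kernel t (y + X n) - heat_kernel t y\<bar>) \<longlonglongrightarrow> (LINT y::real^'n|lborel. (0 :: real))"
  proof (rule integral_dominated_convergence)
    show "integrable lborel (\<lambda>y. 2 * g y)"
      unfolding g_def using t by (intro integrable_mult_right integrable_gaussian) auto
    show "AE y in lborel. norm \<bar>heat_kernel t (y + X n) - heat_kernel t y\<bar> \<le> 2 * g y" for n
    proof (rule AE_I2)
      fix y
      show "norm \<bar>heat_kernel t (y + X n) - heat_kernel t y\<bar> \<le> 2 * g y"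
        using bound[OF B[of n], of y] bound[of 0 y] \<open>B \<ge> 0\<close>
          heat_kernel_nonneg[of t "y + X n"] heat_kernel_nonneg[of t y] by simp
    qed
    show "AE y in lborel. (\<lambda>n. \<bar>heat_kernel t (y + X n) - heat_kernel t y\<bar>) \<longlonglongrightarrow> 0"
    proof (rule AE_I2)
      fix y
      have "(\<lambda>n. heat_kernel t (y + X n)) \<longlonglongrightarrow> heat_kernel t (y + 0)"
        unfolding heat_kernel_def using t by (intro tendsto_intros X) auto
      then show "(\<lambda>n. \<bar>heat_kernel t (y + X n) - heat_kernel t y\<bar>) \<longlonglongrightarrow> 0"
        by (intro tendsto_rabs_zero) (simp add: LIM_zero)
    qed
  qed auto
  then show "(\<lambda>n. LINT y|lborel. \<bar>heat_kernel t (y + X n) - heat_kernel t y\<bar>) \<longlonglongrightarrow> 0"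
    by simp
qed

lemma heat_kernel_scaling:
  assumes r: "r > 0"
  shows "sqrt r ^ CARD('n) * heat_kernel r (sqrt r *\<^sub>R (z :: real^'n)) = heat_kernel 1 z"
proof -
  have "sqrt r ^ CARD('n) = r powr (CARD('n) / 2)"
    using r by (simp add: powr_half_sqrt[symmetric] powr_power)
  moreover have "(4 * pi * r) powr (- (CARD('n) / 2)) = (4 * pi) powr (- (CARD('n) / 2)) * r powr (- (CARD('n) / 2))"
    using r by (simp add: powr_mult)
  moreover have "r powr (CARD('n) / 2) * r powr (- (CARD('n) / 2)) = 1"
    using r by (simp flip: powr_add)
  moreover have "- (norm (sqrt r *\<^sub>R z))\<^sup>2 / (4 * r) = - (norm z)\<^sup>2 / (4 * 1)"
    using r by (simp add: power_mult_distrib)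
  ultimately show ?thesis
    unfolding heat_kernel_def by (simp only: mult.assoc[symmetric] mult_1_right) (simp add: mult_ac)
qed

section \<open>The heat semigroup\<close>

definition heat_semigroup :: "real \<Rightarrow> ((real^'n) \<Rightarrow>\<^sub>C real) \<Rightarrow>\<^sub>L ((real^'n) \<Rightarrow>\<^sub>C real)" where
  "heat_semigroup t = conv_op (heat_kernel t)"

lemma norm_heat_semigroup_le: "t > 0 \<Longrightarrow> norm (heat_semigroup t) \<le> 1"
  using norm_conv_op_le[OF integrable_heat_kernel, of t]
  by (simp add: heat_semigroup_def heat_kernel_nonneg integral_heat_kernel)

lemma norm_heat_semigroup_apply_le: "t > 0 \<Longrightarrow> norm (blinfun_apply (heat_semigroup t) v) \<le> norm v"
  using order_trans[OF norm_blinfun[of "heat_semigroup t" v]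
      mult_right_mono[OF norm_heat_semigroup_le, of t "norm v"]] by simp

text \<open>Smoothing: positive times produce uniformly continuous functions from merely bounded continuous ones.\<close>
lemma heat_semigroup_BUC: "t > 0 \<Longrightarrow> blinfun_apply (heat_semigroup t) v \<in> BUC"
  unfolding heat_semigroup_def
  by (intro conv_op_smoothing_BUC integrable_heat_kernel heat_kernel_L1_translation)

lemma heat_semigroup_has_vector_derivative:
  assumes t: "t > 0"
  shows "(heat_semigroup has_vector_derivative conv_op (heat_kernel_dt t)) (at t)"
  unfolding heat_semigroup_def[abs_def]
proof (rule conv_op_has_vector_derivative[of "t / 2", OF _ _ _ _ integrable_heat_majorant[OF t]])
  fix s :: real and y :: "real^'a"
  assume s: "\<bar>s - t\<bar> < t / 2"
  then have "s > 0" by linarith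
  then show "integrable lborel (heat_kernel s :: real^'a \<Rightarrow> real)"
    and "((\<lambda>s. heat_kernel s y) has_real_derivative heat_kernel_dt s y) (at s)"
    by (rule integrable_heat_kernel, rule heat_kernel_has_derivative)
  show "\<bar>heat_kernel_dt s y\<bar> \<le> heat_majorant t y"
    using s by (rule heat_kernel_dt_le_majorant)
qed (use t in simp)

lemma continuous_on_conv_heat_kernel_dt: "continuous_on {0<..} (\<lambda>t. conv_op (heat_kernel_dt t))"
proof (intro continuous_at_imp_continuous_on ballI)
  fix t :: real assume "t \<in> {0<..}"
  then have t: "t > 0" by simp
  have near: "\<forall>\<^sub>F s in at t. \<bar>s - t\<bar> < t / 2"
    unfolding eventually_at using t by (intro exI[of _ "t / 2"]) (auto simp: dist_real_def)
  have "((\<lambda>s. conv_op (heat_kernel_dt s)) \<longlongrightarrow> conv_op (heat_kernel_dt t)) (at t)"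
  proof (rule conv_op_tendsto_filter[OF _ integrable_heat_majorant[OF t]])
    show "\<forall>\<^sub>F s in at t. integrable lborel (heat_kernel_dt s) \<and> (\<forall>y. \<bar>heat_kernel_dt s y\<bar> \<le> heat_majorant t y)"
      using near
    proof eventually_elim
      case (elim s)
      then have "s > 0" by linarith
      with elim show ?case by (auto intro: integrable_heat_kernel_dt heat_kernel_dt_le_majorant)
    qed
    show "((\<lambda>s. heat_kernel_dt s y) \<longlongrightarrow> heat_kernel_dt t y) (at t)" for y
      using heat_kernel_dt_isCont[OF t, of y] by (simp add: isCont_def)
  qed
  then show "isCont (\<lambda>t. conv_op (heat_kernel_dt t)) t"
    by (simp add: isCont_def)
qed

text \<open>After the substitution \<open>y = sqrt r z\<close> the kernel is fixed and the small time only moves the argument of \<open>v\<close>,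
where continuity of \<open>v\<close> at \<open>x\<close> suffices.\<close>
lemma heat_semigroup_tendsto_pointwise:
  assumes r: "\<And>n. r n > 0" "r \<longlonglongrightarrow> 0"
  shows "(\<lambda>n. blinfun_apply (heat_semigroup (r n)) v x) \<longlonglongrightarrow> v (x :: real^'n)"
proof -
  have "blinfun_apply (heat_semigroup s) v x = (LINT z|lborel. heat_kernel 1 z * v (x - sqrt s *\<^sub>R z))"
    if s: "s > 0" for s
  proof -
    have "blinfun_apply (heat_semigroup s) v x =
        sqrt s ^ CARD('n) * (LINT z|lborel. heat_kernel s (sqrt s *\<^sub>R z) * v (x - sqrt s *\<^sub>R z))"
      using s lborel_integral_affine[of "\<lambda>y. heat_kernel s y * v (x - y)" "sqrt s" 0]
      by (simp add: heat_semigroup_def conv_op_apply[OF integrable_heat_kernel])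
    also have "\<dots> = (LINT z|lborel. heat_kernel 1 z * v (x - sqrt s *\<^sub>R z))"
      by (simp only: integral_mult_right_zero[symmetric] mult.assoc[symmetric] heat_kernel_scaling[OF s])
    finally show ?thesis .
  qed
  moreover have "(\<lambda>n. LINT z|lborel. heat_kernel 1 z * v (x - sqrt (r n) *\<^sub>R z)) \<longlonglongrightarrow>
      (LINT z :: real^'n|lborel. heat_kernel 1 z * v x)"
  proof (rule integral_dominated_convergence)
    show "integrable lborel (\<lambda>z :: real^'n. heat_kernel 1 z * norm v)"
      by (intro integrable_mult_left integrable_heat_kernel) simp
    show "AE z in lborel. (\<lambda>n. heat_kernel 1 z * v (x - sqrt (r n) *\<^sub>R z)) \<longlonglongrightarrow> heat_kernel 1 z * v x"
    proof (rule AE_I2)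
      fix z
      have "(\<lambda>n. x - sqrt (r n) *\<^sub>R z) \<longlonglongrightarrow> x - sqrt 0 *\<^sub>R z"
        by (intro tendsto_intros r)
      then have "(\<lambda>n. x - sqrt (r n) *\<^sub>R z) \<longlonglongrightarrow> x" by simp
      then show "(\<lambda>n. heat_kernel 1 z * v (x - sqrt (r n) *\<^sub>R z)) \<longlonglongrightarrow> heat_kernel 1 z * v x"
        by (intro tendsto_intros continuous_on_tendsto_compose[of UNIV "apply_bcontfun v"]) auto
    qed
    show "AE z in lborel. norm (heat_kernel 1 z * v (x - sqrt (r n) *\<^sub>R z)) \<le> heat_kernel 1 z * norm v" for n
      by (auto simp: abs_mult heat_kernel_nonneg intro!: mult_left_mono abs_apply_bcontfun_le)
  qed auto
  ultimately show ?thesis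
    using r by (simp add: integral_heat_kernel)
qed

section \<open>The semigroup and the distributional Laplacian\<close>

lemma test_function_integrable:
  assumes "\<phi> \<in> test_functions"
  shows "integrable lborel \<phi>" and "integrable lborel (classical_laplacian \<phi>)"
proof -
  obtain R where R: "\<And>x. R < norm x \<Longrightarrow> \<phi> x = 0"
    using test_functionE[OF assms] by blast
  have "Ck 2 \<phi>" "Ck 1 \<phi>"
    using assms by (auto simp: test_functions_def)
  then have c: "continuous_on UNIV \<phi>" "continuous_on UNIV (partial i (partial i \<phi>))" for i
    using Ck_continuous[of 1] by (auto simp: numeral_2_eq_2 simp del: One_nat_def)
  show "integrable lborel \<phi>"
    by (rule integrable_continuous_bounded_support[OF c(1) R])
  have R': "partial i (partial i \<phi>) x = 0" if "R < norm x" for i x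
    by (intro partial_eq_0_outside[of R] R that)
  show "integrable lborel (classical_laplacian \<phi>)"
    unfolding classical_laplacian_def
    by (intro Bochner_Integration.integrable_sum integrable_continuous_bounded_support[OF c(2) R'])
qed

text \<open>Fubini's theorem moves the convolution onto the test function, and Green's identity then moves the Laplacian
onto the kernel.\<close>
lemma has_laplacian_heat_semigroup:
  assumes t: "t > 0"
  shows "has_laplacian (blinfun_apply (heat_semigroup t) f) (blinfun_apply (conv_op (heat_kernel_dt t)) f)"
  unfolding has_laplacian_def
proof
  fix \<phi> :: "real^'a \<Rightarrow> real" assume \<phi>: "\<phi> \<in> test_functions"
  have "(LINT x|lborel. heat_kernel t (x - z) * classical_laplacian \<phi> x) =
        (LINT x|lborel. heat_kernel_dt t (x - z) * \<phi> x)" for z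
    using green_identity[OF Ck_heat_kernel[OF t] \<phi>, of z]
    unfolding classical_laplacian_heat_kernel[OF t] .
  then show "(LINT x|lborel. blinfun_apply (heat_semigroup t) f x * classical_laplacian \<phi> x) =
      (LINT x|lborel. blinfun_apply (conv_op (heat_kernel_dt t)) f x * \<phi> x)"
    by (simp only: heat_semigroup_def conv_op_adjoint[OF integrable_heat_kernel[OF t] test_function_integrable(2)[OF \<phi>]]
          conv_op_adjoint[OF integrable_heat_kernel_dt[OF t] test_function_integrable(1)[OF \<phi>]])
qed

text \<open>A Gaussian is not a test function, so it is multiplied by a smooth cutoff of radius \<open>1 / sqrt \<rho>\<close>. Centring the cutoff at
the centre of the Gaussian keeps the product radial. The Laplacian is written out so that the
limit \<open>\<rho> \<rightarrow> 0\<close> can be read off: every derivative that falls on the cutoff carries a factor \<open>\<rho>\<close>.\<close>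
lemma truncated_gaussian:
  fixes a \<rho> :: real and x :: "real^'n"
  assumes a: "a > 0" and \<rho>: "\<rho> > 0"
  defines "\<phi> \<equiv> \<lambda>y. exp (- (a * (norm (y - x))\<^sup>2)) * bump 0 (1 - \<rho> * (norm (y - x))\<^sup>2)"
  shows "\<phi> \<in> test_functions"
    and "classical_laplacian \<phi> y = (let s = (norm (y - x))\<^sup>2; b = (\<lambda>j. bump j (1 - \<rho> * s)) in
      exp (- (a * s)) * (4 * s * (a\<^sup>2 * b 0 + 2 * a * \<rho> * b 1 + \<rho>\<^sup>2 * b 2)
        - 2 * real CARD('n) * (a * b 0 + \<rho> * b 1)))"
proof -
  define E where "E j s = (- a) ^ j * exp (- (a * s))" for j :: nat and s
  have E: "(E j has_real_derivative E (Suc j) s) (at s)" for j s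
    unfolding E_def by (auto intro!: derivative_eq_intros)
  define b where "b j s = (- \<rho>) ^ j * bump j (1 - \<rho> * s)" for j :: nat and s
  have b: "(b j has_real_derivative b (Suc j) s) (at s)" for j s
    unfolding b_def by (auto intro!: derivative_eq_intros bump_has_derivative[THEN DERIV_chain2])
  have \<phi>: "\<phi> = (\<lambda>y. E 0 ((norm (y - x))\<^sup>2) * b 0 ((norm (y - x))\<^sup>2))"
    by (simp add: \<phi>_def E_def b_def)
  have "Ck k \<phi>" for k
    unfolding \<phi>
    by (rule Ck_mult[OF Ck_compose[where h = E and n = 0, OF E Ck_norm_square]
          Ck_compose[where h = b and n = 0, OF b Ck_norm_square]])
  moreover have "{y. \<phi> y \<noteq> 0} \<subseteq> cball x (1 / sqrt \<rho>)"
  proof safe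
    fix y assume "\<phi> y \<noteq> 0"
    then have "\<rho> * (norm (y - x))\<^sup>2 < 1"
      by (auto simp: \<phi>_def bump_def split: if_splits)
    then have "(norm (y - x))\<^sup>2 \<le> 1 / \<rho>"
      using \<rho> by (simp add: pos_le_divide_eq mult.commute)
    also have "\<dots> = (1 / sqrt \<rho>)\<^sup>2"
      using \<rho> by (simp add: power_divide)
    finally have "norm (y - x) \<le> 1 / sqrt \<rho>"
      by (rule power2_le_imp_le) (use \<rho> in simp)
    then show "y \<in> cball x (1 / sqrt \<rho>)"
      by (simp add: dist_norm norm_minus_commute)
  qed
  then have "compact (closure {y. \<phi> y \<noteq> 0})"
    unfolding compact_closure by (rule bounded_subset[OF bounded_cball])
  ultimately show "\<phi> \<in> test_functions"
    by (simp add: test_functions_def)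
  have d: "((\<lambda>s. E i s * b j s) has_real_derivative E i s * b (Suc j) s + E (Suc i) s * b j s) (at s)" for i j s
    by (rule DERIV_cong[OF DERIV_mult[OF E b]]) simp
  have d2: "((\<lambda>s. E 0 s * b 1 s + E 1 s * b 0 s) has_real_derivative
      (E 0 s * b 2 s + E 1 s * b 1 s) + (E 1 s * b 1 s + E 2 s * b 0 s)) (at s)" for s
    by (rule DERIV_cong[OF DERIV_add[OF d[of 0 1] d[of 1 0]]]) (simp add: numeral_2_eq_2)
  have d1: "((\<lambda>s. E 0 s * b 0 s) has_real_derivative E 0 s * b 1 s + E 1 s * b 0 s) (at s)" for s
    using d[of 0 0] by simp
  define s where "s = (norm (y - x))\<^sup>2"
  have "classical_laplacian \<phi> y = 4 * s * ((E 0 s * b 2 s + E 1 s * b 1 s) + (E 1 s * b 1 s + E 2 s * b 0 s))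
      + 2 * real CARD('n) * (E 0 s * b 1 s + E 1 s * b 0 s)"
    unfolding \<phi> s_def by (rule classical_laplacian_radial[OF d1 d2])
  also have "\<dots> = exp (- (a * s)) *
      (4 * s * (a\<^sup>2 * bump 0 (1 - \<rho> * s) + 2 * a * \<rho> * bump 1 (1 - \<rho> * s) + \<rho>\<^sup>2 * bump 2 (1 - \<rho> * s))
        - 2 * real CARD('n) * (a * bump 0 (1 - \<rho> * s) + \<rho> * bump 1 (1 - \<rho> * s)))"
    unfolding E_def b_def by (simp del: One_nat_def) algebra
  finally show "classical_laplacian \<phi> y = (let s = (norm (y - x))\<^sup>2; b = (\<lambda>j. bump j (1 - \<rho> * s)) in
      exp (- (a * s)) * (4 * s * (a\<^sup>2 * b 0 + 2 * a * \<rho> * b 1 + \<rho>\<^sup>2 * b 2)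
        - 2 * real CARD('n) * (a * b 0 + \<rho> * b 1)))"
    by (simp only: s_def Let_def)
qed

text \<open>The heart of the argument: the heat semigroup commutes with the distributional Laplacian. The definition of the
distributional Laplacian is tested with truncated heat kernels centred at \<open>x\<close>, and the truncation is removed by
dominated convergence.\<close>
lemma heat_semigroup_laplacian:
  assumes vw: "has_laplacian v w" and t: "t > 0"
  shows "blinfun_apply (conv_op (heat_kernel_dt t)) v = blinfun_apply (heat_semigroup t) w"
proof (rule bcontfun_eqI)
  fix x :: "real^'a"
  define a where "a = 1 / (4 * t)"
  have a: "a > 0" using t by (simp add: a_def)
  \<comment> \<open>The cutoff tends to the constant \<open>\<beta>\<close> as its radius \<open>1 / sqrt (\<rho> m)\<close> grows.\<close>
  define \<beta> where "\<beta> = bump 0 1"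
  have \<beta>: "\<beta> > 0" by (simp add: \<beta>_def bump_def)
  define \<rho> where "\<rho> m = inverse (real (Suc m))" for m
  have \<rho>: "\<rho> m > 0" "\<rho> m \<le> 1" for m by (auto simp: \<rho>_def divide_simps)
  have \<rho>0: "\<rho> \<longlonglongrightarrow> 0" unfolding \<rho>_def by (rule LIMSEQ_inverse_real_of_nat)
  define \<phi> where "\<phi> m y = exp (- (a * (norm (y - x))\<^sup>2)) * bump 0 (1 - \<rho> m * (norm (y - x))\<^sup>2)" for m y
  define e where "e y = exp (- (a * (norm (y - x))\<^sup>2))" for y
  \<comment> \<open>The Laplacian of the Gaussian \<open>e\<close>.\<close>
  define L where "L y = e y * (4 * (norm (y - x))\<^sup>2 * a\<^sup>2 - 2 * real CARD('a) * a)" for y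
  note tg = truncated_gaussian[OF a \<rho>(1), of x, folded \<phi>_def]
  have bump_lim: "(\<lambda>m. bump j (1 - \<rho> m * s)) \<longlonglongrightarrow> bump j 1" for j s
  proof -
    have "(\<lambda>m. 1 - \<rho> m * s) \<longlonglongrightarrow> 1 - 0 * s" by (intro tendsto_intros \<rho>0)
    then have "(\<lambda>m. 1 - \<rho> m * s) \<longlonglongrightarrow> 1" by simp
    then show ?thesis
      by (rule isCont_tendsto_compose[OF DERIV_isCont[OF bump_has_derivative]])
  qed
  have "\<forall>j. \<exists>B. \<forall>s\<le>1. \<bar>bump j s\<bar> \<le> B"
    using bump_bounded by blast
  then obtain B' where "\<forall>j. \<forall>s\<le>1. \<bar>bump j s\<bar> \<le> B' j"
    by (auto dest: choice)
  then have B': "\<bar>bump j s\<bar> \<le> B' j" if "s \<le> 1" for j s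
    using that by simp
  define B where "B = Max (B' ` {0, 1, 2})"
  have B: "\<bar>bump j s\<bar> \<le> B" if "s \<le> 1" "j \<in> {0, 1, 2}" for s j
    unfolding B_def using that by (intro order_trans[OF B'] Max_ge) auto
  have B0: "B \<ge> 0" by (rule order_trans[OF abs_ge_zero B[of 0 0]]) auto
  have ie: "integrable lborel e"
    unfolding e_def using lborel_integrable_translate[OF integrable_gaussian[OF a], of "- x"] by simp
  have ie2: "integrable lborel (\<lambda>y. (norm (y - x))\<^sup>2 * e y)"
    unfolding e_def using lborel_integrable_translate[OF integrable_gaussian_moment[OF a], of "- x"] by simp
  have [measurable]: "e \<in> borel_measurable borel" unfolding e_def[abs_def] by measurable
  have mphi: "\<phi> m \<in> borel_measurable borel" "classical_laplacian (\<phi> m) \<in> borel_measurable borel" for m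
    using test_function_integrable[OF tg(1), THEN borel_measurable_integrable] by auto
  have lim_w: "(\<lambda>m. LINT y|lborel. w y * \<phi> m y) \<longlonglongrightarrow> (LINT y|lborel. w y * (e y * \<beta>))"
  proof (rule integral_dominated_convergence)
    show "integrable lborel (\<lambda>y. norm w * (e y * B))" using ie by simp
    show "AE y in lborel. (\<lambda>m. w y * \<phi> m y) \<longlonglongrightarrow> w y * (e y * \<beta>)"
      unfolding \<phi>_def \<beta>_def e_def by (intro AE_I2 tendsto_mult tendsto_const bump_lim)
    show "AE y in lborel. norm (w y * \<phi> m y) \<le> norm w * (e y * B)" for m
    proof (rule AE_I2)
      fix y
      have "\<bar>w y\<bar> * (e y * \<bar>bump 0 (1 - \<rho> m * (norm (y - x))\<^sup>2)\<bar>) \<le> norm w * (e y * B)"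
        using \<rho>(1)[of m] by (intro mult_mono abs_apply_bcontfun_le B) (auto simp: e_def)
      then show "norm (w y * \<phi> m y) \<le> norm w * (e y * B)"
        by (simp add: \<phi>_def e_def abs_mult)
    qed
  qed (use mphi in measurable)
  have lim_v: "(\<lambda>m. LINT y|lborel. v y * classical_laplacian (\<phi> m) y) \<longlonglongrightarrow> (LINT y|lborel. v y * (L y * \<beta>))"
  proof (rule integral_dominated_convergence)
    let ?n = "real CARD('a)"
    show "integrable lborel (\<lambda>y. norm v * (4 * (a + 1)\<^sup>2 * B * ((norm (y - x))\<^sup>2 * e y) + 2 * ?n * (a + 1) * B * e y))"
      by (intro integrable_mult_right Bochner_Integration.integrable_add ie ie2)
    show "AE y in lborel. (\<lambda>m. v y * classical_laplacian (\<phi> m) y) \<longlonglongrightarrow> v y * (L y * \<beta>)"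
    proof (rule AE_I2)
      fix y
      let ?s = "(norm (y - x))\<^sup>2"
      have "(\<lambda>m. v y * classical_laplacian (\<phi> m) y) \<longlonglongrightarrow>
        v y * (exp (- (a * ?s)) * (4 * ?s * (a\<^sup>2 * bump 0 1 + 2 * a * 0 * bump 1 1 + 0\<^sup>2 * bump 2 1)
        - 2 * real CARD('a) * (a * bump 0 1 + 0 * bump 1 1)))"
        unfolding tg(2) Let_def by (intro tendsto_intros bump_lim \<rho>0)
      then show "(\<lambda>m. v y * classical_laplacian (\<phi> m) y) \<longlonglongrightarrow> v y * (L y * \<beta>)"
        by (simp add: L_def e_def \<beta>_def algebra_simps)
    qed
    show "AE y in lborel. norm (v y * classical_laplacian (\<phi> m) y) \<le>
        norm v * (4 * (a + 1)\<^sup>2 * B * ((norm (y - x))\<^sup>2 * e y) + 2 * ?n * (a + 1) * B * e y)" for m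
    proof (rule AE_I2)
      fix y
      define s where "s = (norm (y - x))\<^sup>2"
      define b where "b j = bump j (1 - \<rho> m * s)" for j
      have s: "s \<ge> 0" by (simp add: s_def)
      have b: "\<bar>b j\<bar> \<le> B" if "j \<in> {0, 1, 2}" for j
        unfolding b_def using \<rho>(1)[of m] s that by (intro B) auto
      define r where "r = \<rho> m"
      have r: "0 \<le> r" "r \<le> 1" using \<rho>[of m] by (auto simp: r_def)
      \<comment> \<open>Since \<open>r \<le> 1\<close>, all coefficients are bounded independently of \<open>m\<close>.\<close>
      have "\<bar>a * b 0 + r * b 1\<bar> \<le> a * \<bar>b 0\<bar> + r * \<bar>b 1\<bar>"
        using a r by (intro order_trans[OF abs_triangle_ineq]) (simp add: abs_mult)
      also have "\<dots> \<le> a * B + 1 * B"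
        using a r b by (intro add_mono mult_mono) auto
      finally have 1: "\<bar>a * b 0 + r * b 1\<bar> \<le> (a + 1) * B" by (simp add: algebra_simps)
      have "\<bar>a\<^sup>2 * b 0 + 2 * a * r * b 1 + r\<^sup>2 * b 2\<bar> \<le> a\<^sup>2 * \<bar>b 0\<bar> + 2 * a * r * \<bar>b 1\<bar> + r\<^sup>2 * \<bar>b 2\<bar>"
        using a r by (intro order_trans[OF abs_triangle_ineq] add_mono) (auto simp: abs_mult)
      also have "\<dots> \<le> a\<^sup>2 * B + 2 * a * 1 * B + 1\<^sup>2 * B"
        using a r b B0 by (intro add_mono mult_mono power_mono) auto
      finally have 2: "\<bar>a\<^sup>2 * b 0 + 2 * a * r * b 1 + r\<^sup>2 * b 2\<bar> \<le> (a + 1)\<^sup>2 * B"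
        by (simp add: algebra_simps power2_eq_square)
      have "\<bar>4 * s * (a\<^sup>2 * b 0 + 2 * a * r * b 1 + r\<^sup>2 * b 2) - 2 * ?n * (a * b 0 + r * b 1)\<bar> \<le>
          4 * s * \<bar>a\<^sup>2 * b 0 + 2 * a * r * b 1 + r\<^sup>2 * b 2\<bar> + 2 * ?n * \<bar>a * b 0 + r * b 1\<bar>"
        using s by (intro order_trans[OF abs_triangle_ineq4]) (simp add: abs_mult)
      also have "\<dots> \<le> 4 * s * ((a + 1)\<^sup>2 * B) + 2 * ?n * ((a + 1) * B)"
        using s 1 2 by (intro add_mono mult_left_mono) auto
      finally have 3: "\<bar>4 * s * (a\<^sup>2 * b 0 + 2 * a * r * b 1 + r\<^sup>2 * b 2) - 2 * ?n * (a * b 0 + r * b 1)\<bar> \<le>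
          4 * s * ((a + 1)\<^sup>2 * B) + 2 * ?n * ((a + 1) * B)" .
      have "norm (v y * classical_laplacian (\<phi> m) y) = \<bar>v y\<bar> *
          (e y * \<bar>4 * s * (a\<^sup>2 * b 0 + 2 * a * r * b 1 + r\<^sup>2 * b 2) - 2 * ?n * (a * b 0 + r * b 1)\<bar>)"
        unfolding tg(2) Let_def by (simp add: abs_mult e_def s_def b_def r_def)
      also have "\<dots> \<le> norm v * (e y * (4 * s * ((a + 1)\<^sup>2 * B) + 2 * ?n * ((a + 1) * B)))"
        by (intro mult_mono abs_apply_bcontfun_le 3) (auto simp: e_def)
      also have "\<dots> = norm v * (4 * (a + 1)\<^sup>2 * B * (s * e y) + 2 * ?n * (a + 1) * B * e y)"
        by (simp add: algebra_simps)
      finally show "norm (v y * classical_laplacian (\<phi> m) y) \<le>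
        norm v * (4 * (a + 1)\<^sup>2 * B * ((norm (y - x))\<^sup>2 * e y) + 2 * ?n * (a + 1) * B * e y)"
        by (simp add: s_def)
    qed
  qed (use mphi in \<open>unfold L_def, measurable\<close>)
  have "(\<lambda>m. LINT y|lborel. v y * classical_laplacian (\<phi> m) y) = (\<lambda>m. LINT y|lborel. w y * \<phi> m y)"
    using vw tg(1) by (auto simp: has_laplacian_def)
  with lim_v lim_w have "(LINT y|lborel. v y * (L y * \<beta>)) = (LINT y|lborel. w y * (e y * \<beta>))"
    by (auto intro: LIMSEQ_unique)
  then have "(LINT y|lborel. L y * v y * \<beta>) = (LINT y|lborel. e y * w y * \<beta>)"
    by (simp only: mult_ac)
  \<comment> \<open>The factor \<open>\<beta>\<close> from the cutoff cancels; the heat kernel is a constant multiple of \<open>e\<close>.\<close>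
  then have eq: "(LINT y|lborel. L y * v y) = (LINT y|lborel. e y * w y)"
    using \<beta> by simp
  define c where "c = (4 * pi * t) powr (- (CARD('a) / 2))"
  have K: "heat_kernel t (x - y) = c * e y" for y
    unfolding heat_kernel_minus[of t x y] by (simp add: heat_kernel_def c_def e_def a_def)
  have K': "heat_kernel_dt t (x - y) = c * L y" for y
    unfolding heat_kernel_dt_def K L_def a_def using t
    by (simp add: norm_minus_commute[of x y] divide_simps power2_eq_square)
  show "blinfun_apply (conv_op (heat_kernel_dt t)) v x = blinfun_apply (heat_semigroup t) w x"
    unfolding heat_semigroup_def conv_op_apply'[OF integrable_heat_kernel[OF t]]
      conv_op_apply'[OF integrable_heat_kernel_dt[OF t]] K K' mult.assoc
    by (simp add: eq)
qed

lemma bounded_linear_apply_bcontfun: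
  "bounded_linear (\<lambda>f :: 'a::topological_space \<Rightarrow>\<^sub>C real. apply_bcontfun f x)"
  by (rule bounded_linear_intro[of _ 1])
     (auto simp: plus_bcontfun.rep_eq scaleR_bcontfun.rep_eq abs_apply_bcontfun_le)

lemma heat_semigroup_apply_has_vector_derivative:
  assumes "t > 0"
  shows "((\<lambda>t. blinfun_apply (heat_semigroup t) f) has_vector_derivative
     blinfun_apply (conv_op (heat_kernel_dt t)) f) (at t)"
  by (rule bounded_linear.has_vector_derivative[OF blinfun.bounded_linear_left
        heat_semigroup_has_vector_derivative[OF assms]])

text \<open>On the domain of the Laplacian the curve \<open>s \<mapsto> heat_semigroup s v\<close> has derivative \<open>heat_semigroup s w\<close>, of norm at
most \<open>norm w\<close>. The mean value inequality on \<open>[s, t]\<close> followed by the pointwise limit \<open>s \<rightarrow> 0\<close> gives the bound.\<close>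
lemma norm_heat_semigroup_diff_le:
  assumes vw: "has_laplacian v w" and t: "t > 0"
  shows "norm (blinfun_apply (heat_semigroup t) v - v) \<le> t * norm w"
proof (rule norm_bound)
  have *: "norm (blinfun_apply (heat_semigroup t) v - blinfun_apply (heat_semigroup s) v) \<le> t * norm w"
    if s: "0 < s" "s \<le> t" for s
  proof -
    have "norm (blinfun_apply (heat_semigroup t) v - blinfun_apply (heat_semigroup s) v) \<le> norm w * norm (t - s)"
    proof (rule differentiable_bound)
      fix r assume r: "r \<in> {s..t}"
      then have "r > 0" using s by simp
      then show "((\<lambda>r. blinfun_apply (heat_semigroup r) v) has_derivative
          (\<lambda>h. h *\<^sub>R blinfun_apply (heat_semigroup r) w)) (at r within {s..t})"
        using heat_semigroup_apply_has_vector_derivative[of r v] heat_semigroup_laplacian[OF vw]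
        by (simp add: has_vector_derivative_def has_derivative_at_withinI)
      show "onorm (\<lambda>h. h *\<^sub>R blinfun_apply (heat_semigroup r) w) \<le> norm w"
        using norm_heat_semigroup_apply_le[OF \<open>r > 0\<close>, of w]
        by (intro onorm_bound) (auto simp: mult.commute[of "norm w"] intro!: mult_left_mono)
    qed (use s in auto)
    also have "\<dots> \<le> norm w * t" using s by (intro mult_left_mono) auto
    finally show ?thesis by (simp add: mult.commute)
  qed
  fix x
  define r where "r n = t * inverse (real (Suc n))" for n
  have r: "0 < r n" "r n \<le> t" for n
    using t by (auto simp: r_def field_simps)
  have "r \<longlonglongrightarrow> t * 0" unfolding r_def by (intro tendsto_mult tendsto_const LIMSEQ_inverse_real_of_nat)
  then have "(\<lambda>n. blinfun_apply (heat_semigroup (r n)) v x) \<longlonglongrightarrow> v x"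
    using r by (intro heat_semigroup_tendsto_pointwise) auto
  then have "(\<lambda>n. \<bar>blinfun_apply (heat_semigroup t) v x - blinfun_apply (heat_semigroup (r n)) v x\<bar>)
      \<longlonglongrightarrow> \<bar>blinfun_apply (heat_semigroup t) v x - v x\<bar>"
    by (intro tendsto_intros)
  moreover have "\<bar>blinfun_apply (heat_semigroup t) v x - blinfun_apply (heat_semigroup (r n)) v x\<bar> \<le> t * norm w" for n
    using order_trans[OF abs_apply_bcontfun_le[of _ x] *[OF r[of n]]] by (simp add: minus_bcontfun.rep_eq)
  ultimately have "\<bar>blinfun_apply (heat_semigroup t) v x - v x\<bar> \<le> t * norm w"
    by (intro tendsto_upperbound[where F = sequentially]) auto
  then show "norm ((blinfun_apply (heat_semigroup t) v - v) x) \<le> t * norm w"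
    by (simp add: minus_bcontfun.rep_eq)
qed

text \<open>The linear rate of convergence on the domain extends to convergence on its closure because the operators are contractions.\<close>
lemma heat_semigroup_strongly_continuous:
  assumes f: "f \<in> closure (laplacian_domain Z)"
  shows "((\<lambda>t. blinfun_apply (heat_semigroup t) f) \<longlongrightarrow> f) (at_right 0)"
proof (rule tendstoI)
  fix e :: real assume e: "e > 0"
  then obtain v where v: "v \<in> laplacian_domain Z" "dist v f < e / 3"
    using f unfolding closure_approachable by (meson divide_pos_pos zero_less_numeral)
  then obtain w where w: "has_laplacian v w" by (auto simp: laplacian_domain_def)
  define N where "N = norm w + 1"
  have N: "N > 0" "norm w \<le> N" by (auto simp: N_def add_nonneg_pos)
  define d where "d = e / (3 * N)"
  have d: "d > 0" using e N by (simp add: d_def)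
  have "dist (blinfun_apply (heat_semigroup t) f) f < e" if t: "0 < t" "t < d" for t
  proof -
    have "norm (blinfun_apply (heat_semigroup t) f - f) \<le>
        norm (blinfun_apply (heat_semigroup t) (f - v)) + norm (blinfun_apply (heat_semigroup t) v - v) + norm (v - f)"
      using norm_triangle_ineq[of "blinfun_apply (heat_semigroup t) (f - v) + (blinfun_apply (heat_semigroup t) v - v)" "v - f"]
        norm_triangle_ineq[of "blinfun_apply (heat_semigroup t) (f - v)" "blinfun_apply (heat_semigroup t) v - v"]
      by (simp add: blinfun.diff_right)
    moreover have "norm (blinfun_apply (heat_semigroup t) (f - v)) \<le> norm (f - v)"
      by (rule norm_heat_semigroup_apply_le[OF t(1)])
    moreover have "norm (f - v) < e / 3" "norm (v - f) < e / 3"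
      using v(2) by (auto simp: dist_norm norm_minus_commute)
    moreover have "t * norm w \<le> d * N"
      using t N by (intro mult_mono) auto
    moreover have "d * N = e / 3"
      using N by (simp add: d_def)
    moreover note norm_heat_semigroup_diff_le[OF w t(1)]
    ultimately show ?thesis by (simp add: dist_norm)
  qed
  then show "\<forall>\<^sub>F t in at_right 0. dist (blinfun_apply (heat_semigroup t) f) f < e"
    using d by (auto simp: eventually_at_right_field)
qed

text \<open>Even for \<open>Z = UNIV\<close> the initial datum is uniformly continuous, being a uniform limit of functions that the
semigroup has smoothed. Consequently every solution in the theorem is continuous up to time \<open>0\<close>, without which the initial
datum would not determine it.\<close>
lemma laplacian_domain_closure_subset_BUC:
  assumes f: "f \<in> laplacian_domain_closure Z"
  shows "f \<in> BUC"
proof -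
  have "((\<lambda>t. blinfun_apply (heat_semigroup t) f) \<longlongrightarrow> f) (at_right 0)"
    using f by (intro heat_semigroup_strongly_continuous) (auto simp: laplacian_domain_closure_def)
  moreover have "\<forall>\<^sub>F t in at_right 0. blinfun_apply (heat_semigroup t) f \<in> BUC"
    by (rule eventually_mono[OF eventually_at_right_less]) (rule heat_semigroup_BUC)
  ultimately show ?thesis
    by (rule Lim_in_closed_set[OF closed_BUC, rotated 2]) (simp add: trivial_limit_at_right_real)
qed

section \<open>Existence and uniqueness of solutions\<close>

text \<open>Time \<open>0\<close> is separate because the Gaussian formula degenerates there.\<close>
definition heat_flow :: "((real^'n) \<Rightarrow>\<^sub>C real) \<Rightarrow> real \<Rightarrow> ((real^'n) \<Rightarrow>\<^sub>C real)" where
  "heat_flow f t = (if t > 0 then blinfun_apply (heat_semigroup t) f else f)"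

lemma heat_flow_has_vector_derivative:
  assumes t: "t > 0"
  shows "(heat_flow f has_vector_derivative blinfun_apply (conv_op (heat_kernel_dt t)) f) (at t)"
  by (rule has_vector_derivative_transform_within_open[OF heat_semigroup_apply_has_vector_derivative[OF t],
        of "{0<..}"]) (use t in \<open>auto simp: heat_flow_def\<close>)

lemma continuous_on_heat_flow:
  assumes f: "f \<in> closure (laplacian_domain Z)"
  shows "continuous_on {0..} (heat_flow f)"
  unfolding continuous_on_eq_continuous_within
proof
  fix t :: real assume "t \<in> {0..}"
  then consider "t > 0" | "t = 0" by force
  then show "continuous (at t within {0..}) (heat_flow f)"
  proof cases
    case 1
    then show ?thesis
      using has_vector_derivative_continuous[OF heat_flow_has_vector_derivative] continuous_at_imp_continuous_at_within
      by blast
  next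
    case 2
    have "(heat_flow f \<longlongrightarrow> f) (at_right 0)"
      by (rule Lim_transform_eventually[OF heat_semigroup_strongly_continuous[OF f]])
         (auto simp: heat_flow_def eventually_at_filter)
    then show ?thesis
      by (simp add: 2 continuous_within heat_flow_def at_within_Ici_at_right)
  qed
qed

lemma has_real_derivative_apply_bcontfun:
  assumes "(U has_vector_derivative D) (at t)"
  shows "((\<lambda>s. apply_bcontfun (U s) x) has_real_derivative apply_bcontfun D x) (at t)"
  using bounded_linear.has_vector_derivative[OF bounded_linear_apply_bcontfun assms, of x]
  by (simp add: has_real_derivative_iff_has_vector_derivative)

lemma heat_solution_heat_flow:
  assumes Z: "Z = UNIV \<or> Z = BUC" and f: "f \<in> laplacian_domain_closure Z"
  shows "heat_solution Z f (\<lambda>t. apply_bcontfun (heat_flow f t))"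
proof -
  have fZ: "f \<in> Z" and fcl: "f \<in> closure (laplacian_domain Z)"
    using f by (auto simp: laplacian_domain_closure_def)
  note deriv = heat_flow_has_vector_derivative[of _ f]
  have lap: "has_laplacian (heat_flow f t) (blinfun_apply (conv_op (heat_kernel_dt t)) f)" if "t > 0" for t
    using has_laplacian_heat_semigroup[OF that] that by (simp add: heat_flow_def)
  have "heat_flow f C1_differentiable_on {0<..}"
    unfolding C1_differentiable_on_def
  proof (intro exI conjI ballI)
    show "continuous_on {0<..} (\<lambda>t. blinfun_apply (conv_op (heat_kernel_dt t)) f)"
      by (intro continuous_intros continuous_on_conv_heat_kernel_dt)
  qed (use deriv in auto)
  moreover have "heat_flow f t \<in> laplacian_domain Z" if t: "t > 0" for t
  proof -
    have "heat_flow f t \<in> Z" and "blinfun_apply (conv_op (heat_kernel_dt t)) f \<in> Z"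
      using Z fZ t conv_op_BUC[OF integrable_heat_kernel_dt[OF t]] heat_semigroup_BUC[OF t]
      by (auto simp: heat_flow_def)
    with lap[OF t] show ?thesis
      unfolding laplacian_domain_def by blast
  qed
  moreover have "\<exists>w. has_laplacian (heat_flow f t) w \<and>
      (\<forall>x. ((\<lambda>s. heat_flow f s x) has_real_derivative w x) (at t))" if t: "t > 0" for t
    using lap[OF t] has_real_derivative_apply_bcontfun[OF deriv[OF t]] by blast
  moreover have "heat_flow f 0 = f" by (simp add: heat_flow_def)
  ultimately show ?thesis
    using continuous_on_heat_flow[OF fcl]
    by (auto simp: heat_solution_def apply_bcontfun apply_bcontfun_inverse)
qed

text \<open>Uniqueness by duality in time: for a solution \<open>U\<close>, the curve \<open>g s = heat_semigroup (t - s) (U s)\<close> joins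
\<open>heat_semigroup t f\<close> at \<open>s = 0\<close> to \<open>U t\<close> at \<open>s = t\<close>, and it is constant because the two terms of its
derivative cancel by commutation of the semigroup with the Laplacian.\<close>
lemma heat_solution_eq_heat_semigroup:
  assumes v: "heat_solution Z f v" and f: "f \<in> laplacian_domain_closure Z" and t: "t > 0"
  shows "Bcontfun (v t) = blinfun_apply (heat_semigroup t) f"
proof -
  define U where "U s = Bcontfun (v s)" for s
  have fB: "f \<in> BUC \<inter> laplacian_domain_closure Z"
    using laplacian_domain_closure_subset_BUC[OF f] f by blast
  have U: "apply_bcontfun (U s) = v s" if "s \<ge> 0" for s
    using v fB that by (auto simp: heat_solution_def U_def Bcontfun_inverse)
  have cont: "continuous_on {0..} U"
    using v fB by (auto simp: heat_solution_def U_def[abs_def])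
  have U0: "U 0 = f"
    using v U[of 0] by (intro bcontfun_eqI) (auto simp: heat_solution_def)
  have evol: "\<exists>w. has_laplacian (U s) w \<and> (U has_vector_derivative w) (at s)" if s: "s > 0" for s
  proof -
    obtain w where w: "has_laplacian (U s) w" "\<And>x. ((\<lambda>s. v s x) has_real_derivative w x) (at s)"
      using v s fB by (auto simp: heat_solution_def U_def)
    obtain D where D: "(U has_vector_derivative D) (at s)"
      using v s by (auto simp: heat_solution_def C1_differentiable_on_def U_def[abs_def])
    \<comment> \<open>The derivative in the supremum norm and the pointwise derivative in the heat equation agree.\<close>
    have "apply_bcontfun D x = w x" for x
    proof (rule DERIV_unique)
      show "((\<lambda>s. v s x) has_real_derivative D x) (at s)"
        by (rule has_field_derivative_transform_within_open[OF has_real_derivative_apply_bcontfun[OF D], of "{0<..}"])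
           (use s U in auto)
    qed (rule w)
    then have "D = w" by (rule bcontfun_eqI)
    with w(1) D show ?thesis by blast
  qed
  define g where "g s = blinfun_apply (heat_semigroup (t - s)) (U s)" for s
  have g': "(g has_vector_derivative 0) (at s within {0<..<t})" if s: "s \<in> {0<..<t}" for s
  proof -
    obtain w where w: "has_laplacian (U s) w" "(U has_vector_derivative w) (at s)"
      using evol[of s] s by auto
    have ts: "t - s > 0" using s by simp
    have "((\<lambda>s. t - s) has_vector_derivative - 1) (at s)"
      by (auto intro!: derivative_eq_intros)
    then have "((heat_semigroup \<circ> (\<lambda>s. t - s)) has_vector_derivative - 1 *\<^sub>R conv_op (heat_kernel_dt (t - s))) (at s)"
      by (rule vector_diff_chain_at) (rule heat_semigroup_has_vector_derivative[OF ts])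
    then have "((\<lambda>s. heat_semigroup (t - s)) has_vector_derivative - conv_op (heat_kernel_dt (t - s))) (at s)"
      by (simp add: o_def)
    from bounded_bilinear.has_vector_derivative[OF bounded_bilinear_blinfun_apply this w(2)]
    have "(g has_vector_derivative blinfun_apply (heat_semigroup (t - s)) w
        - blinfun_apply (conv_op (heat_kernel_dt (t - s))) (U s)) (at s)"
      by (simp add: g_def[abs_def] blinfun.minus_left)
    then show ?thesis
      by (simp add: heat_semigroup_laplacian[OF w(1) ts] has_vector_derivative_at_within)
  qed
  obtain c where c: "\<And>s. s \<in> {0<..<t} \<Longrightarrow> g s = c"
    using has_vector_derivative_zero_constant[of "{0<..<t}" g] g' by blast
  have "(g \<longlongrightarrow> c) (at_right 0)"
    by (rule Lim_transform_eventually[OF tendsto_const])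
       (use t c in \<open>auto simp: eventually_at_right_field\<close>)
  moreover have "(g \<longlongrightarrow> blinfun_apply (heat_semigroup t) f) (at_right 0)"
  proof -
    have "isCont heat_semigroup t"
      using heat_semigroup_has_vector_derivative[OF t] by (rule has_vector_derivative_continuous)
    moreover have "((\<lambda>s. t - s) \<longlongrightarrow> t) (at_right 0)"
      by (intro tendsto_eq_intros) auto
    ultimately have 1: "((\<lambda>s. heat_semigroup (t - s)) \<longlongrightarrow> heat_semigroup t) (at_right 0)"
      by (rule isCont_tendsto_compose)
    have 2: "(U \<longlongrightarrow> f) (at_right 0)"
    proof -
      have "(U \<longlongrightarrow> U 0) (at 0 within {0..})"
        using cont by (simp add: continuous_on_def)
      then show ?thesis by (simp add: U0 at_within_Ici_at_right)
    qed
    show ?thesis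
      unfolding g_def by (rule blinfun.tendsto[OF 1 2])
  qed
  ultimately have c_eq: "c = blinfun_apply (heat_semigroup t) f"
    by (rule tendsto_unique[OF trivial_limit_at_right_real])
  obtain w where w: "has_laplacian (U t) w" "(U has_vector_derivative w) (at t)"
    using evol[OF t] by blast
  \<comment> \<open>The semigroup is not differentiable at time \<open>0\<close>, but \<open>U t\<close> lies in the domain of the Laplacian, where the linear rate applies.\<close>
  have "(U \<longlongrightarrow> U t) (at_left t)"
    using has_vector_derivative_continuous[OF w(2)] by (simp add: isCont_def filterlim_at_split)
  then have "((\<lambda>s. norm (U s - U t) + (t - s) * norm w) \<longlongrightarrow> norm (U t - U t) + (t - t) * norm w) (at_left t)"
    by (intro tendsto_intros)
  then have "((\<lambda>s. norm (U s - U t) + (t - s) * norm w) \<longlongrightarrow> 0) (at_left t)" by simp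
  moreover have "\<forall>\<^sub>F s in at_left t. norm (c - U t) \<le> norm (U s - U t) + (t - s) * norm w"
    unfolding eventually_at_left_field
  proof (intro exI[of _ 0] conjI allI impI)
    fix s assume s: "0 < s" "s < t"
    have "c - U t = blinfun_apply (heat_semigroup (t - s)) (U s - U t) +
        (blinfun_apply (heat_semigroup (t - s)) (U t) - U t)"
      using c[of s] s by (simp add: g_def blinfun.diff_right)
    also have "norm \<dots> \<le> norm (U s - U t) + (t - s) * norm w"
      using s by (intro norm_triangle_mono norm_heat_semigroup_apply_le norm_heat_semigroup_diff_le w) auto
    finally show "norm (c - U t) \<le> norm (U s - U t) + (t - s) * norm w" .
  qed (use t in auto)
  ultimately have "norm (c - U t) \<le> 0"
    by (intro tendsto_lowerbound[where F = "at_left t"]) auto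
  then show ?thesis
    using c_eq by (simp add: U_def)
qed

section \<open>Almost automorphy\<close>

text \<open>The common feature of the two kinds of \<open>G\<close>: every point is within a fixed compact set of \<open>G\<close>. For the lattice
this set is the unit cube, for a dense set it is the unit ball.\<close>
lemma relatively_dense:
  fixes G :: "(real^'n) set"
  assumes "G = integer_lattice \<or> closure G = UNIV"
  obtains C where "compact C" and "\<And>x. \<exists>g\<in>G. x - g \<in> C"
  using assms
proof
  assume G: "G = integer_lattice"
  show thesis
  proof (rule that)
    show "compact (cbox (0 :: real^'n) (\<chi> i. 1))" by simp
    fix x :: "real^'n"
    have "(\<chi> i. of_int \<lfloor>x $ i\<rfloor>) \<in> G" by (simp add: G integer_lattice_def)
    moreover have "x - (\<chi> i. of_int \<lfloor>x $ i\<rfloor>) \<in> cbox 0 (\<chi> i. 1)"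
      by (auto simp: mem_box_cart) linarith
    ultimately show "\<exists>g\<in>G. x - g \<in> cbox 0 (\<chi> i. 1)" by blast
  qed
next
  assume G: "closure G = UNIV"
  show thesis
  proof (rule that)
    show "compact (cball (0 :: real^'n) 1)" by simp
    fix x :: "real^'n"
    have "x \<in> closure G" by (simp add: G)
    then obtain g where "g \<in> G" "dist g x < 1"
      unfolding closure_approachable by (meson zero_less_one)
    then show "\<exists>g\<in>G. x - g \<in> cball 0 1"
      by (intro bexI[of _ g]) (auto simp: dist_norm norm_minus_commute)
  qed
qed

text \<open>Equicontinuity passes to the limit function, so closeness on a finite net of \<open>K\<close> spreads to all of \<open>K\<close>.\<close>
lemma equicontinuous_pointwise_imp_uniform_limit:
  fixes F :: "nat \<Rightarrow> 'a::metric_space \<Rightarrow> real"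
  assumes equi: "\<And>e. e > 0 \<Longrightarrow> \<exists>d>0. \<forall>l x y. dist x y < d \<longrightarrow> \<bar>F l x - F l y\<bar> \<le> e"
    and lim: "\<And>x. (\<lambda>l. F l x) \<longlonglongrightarrow> h x" and K: "compact K"
  shows "uniform_limit K F h sequentially"
proof (rule uniform_limitI)
  fix e :: real assume e: "e > 0"
  obtain d where d: "d > 0" "\<And>l x y. dist x y < d \<Longrightarrow> \<bar>F l x - F l y\<bar> \<le> e / 4"
    using equi[of "e / 4"] e by auto
  have h: "\<bar>h x - h y\<bar> \<le> e / 4" if "dist x y < d" for x y
    using d(2)[OF that] by (intro tendsto_upperbound[OF tendsto_rabs[OF tendsto_diff[OF lim lim]]]) auto
  obtain N where N: "finite N" "K \<subseteq> (\<Union>x\<in>N. ball x d)"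
    using seq_compact_imp_totally_bounded[of K] K d(1) by (auto simp: compact_eq_seq_compact_metric)
  have "\<forall>\<^sub>F l in sequentially. \<forall>x\<in>N. \<bar>F l x - h x\<bar> < e / 4"
    using N(1) tendstoD[OF lim, of "e / 4"] e by (simp add: eventually_ball_finite dist_real_def)
  then show "\<forall>\<^sub>F l in sequentially. \<forall>x\<in>K. dist (F l x) (h x) < e"
  proof eventually_elim
    case (elim l)
    show ?case
    proof
      fix x assume "x \<in> K"
      then obtain z where z: "z \<in> N" "dist z x < d" using N by auto
      then have "\<bar>F l z - F l x\<bar> \<le> e / 4" "\<bar>h z - h x\<bar> \<le> e / 4" "\<bar>F l z - h z\<bar> < e / 4"
        using d(2) h elim by auto
      then show "dist (F l x) (h x) < e"
        unfolding dist_real_def using e by linarith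
    qed
  qed
qed

lemma GAA_subsequence:
  fixes b :: "nat \<Rightarrow> real^'n"
  assumes f: "f \<in> GAA G" and b: "\<And>k. b k \<in> G"
  obtains r :: "nat \<Rightarrow> nat" and f' where "strict_mono r" "\<And>t. (\<lambda>l. f (t + b (r l))) \<longlonglongrightarrow> f' t"
    "\<And>t. (\<lambda>l. f' (t - b (r l))) \<longlonglongrightarrow> f t"
proof -
  have "\<exists>(r :: nat \<Rightarrow> nat) f'. strict_mono r \<and> (\<forall>t. (\<lambda>l. f (t + b (r l))) \<longlonglongrightarrow> f' t) \<and>
      (\<forall>t. (\<lambda>l. f' (t - b (r l))) \<longlonglongrightarrow> f t)"
    using f b by (simp add: GAA_def)
  then obtain r :: "nat \<Rightarrow> nat" and f' where "strict_mono r" "\<forall>t. (\<lambda>l. f (t + b (r l))) \<longlonglongrightarrow> f' t"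
    "\<forall>t. (\<lambda>l. f' (t - b (r l))) \<longlonglongrightarrow> f t"
    by (elim exE conjE)
  then show thesis by (intro that[of r f']) auto
qed

text \<open>An arbitrary sequence of shifts is split as \<open>b k = g k + (b k - g k)\<close> with \<open>g k \<in> G\<close> and remainders in a compact set.
Along a subsequence the remainders converge to some \<open>c\<close>, and almost automorphy applies to \<open>g\<close>; by uniform continuity the
shifts by \<open>b k\<close> then behave like shifts by \<open>g k + c\<close>. Uniform continuity also makes all translates
equicontinuous, which upgrades pointwise convergence to uniform convergence on compact sets.\<close>
lemma GAA_BUC_imp_KAA:
  fixes f :: "(real^'n) \<Rightarrow>\<^sub>C real"
  assumes G: "G = integer_lattice \<or> closure G = UNIV"
    and f: "apply_bcontfun f \<in> GAA G" and uc: "f \<in> BUC"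
  shows "apply_bcontfun f \<in> KAA"
  unfolding KAA_def
proof (safe)
  fix b :: "nat \<Rightarrow> real^'n"
  obtain C where C: "compact C" "\<And>x. \<exists>g\<in>G. x - g \<in> C"
    using relatively_dense[OF G] by blast
  define g where "g k = (SOME y. y \<in> G \<and> b k - y \<in> C)" for k
  have "\<exists>y. y \<in> G \<and> b k - y \<in> C" for k
    using C(2)[of "b k"] by blast
  then have g: "g k \<in> G \<and> b k - g k \<in> C" for k
    unfolding g_def by (rule someI_ex)
  have "seq_compact C" using C(1) by (simp add: compact_eq_seq_compact_metric)
  then obtain c q where q: "strict_mono q" "((\<lambda>k. b k - g k) \<circ> q) \<longlonglongrightarrow> c"
    by (rule seq_compactE[where f = "\<lambda>k. b k - g k"]) (simp add: g)
  obtain p f' where p: "strict_mono p"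
    and f': "\<And>t. (\<lambda>l. f (t + g (q (p l)))) \<longlonglongrightarrow> f' t" "\<And>t. (\<lambda>l. f' (t - g (q (p l)))) \<longlonglongrightarrow> f t"
    by (rule GAA_subsequence[OF f, of "\<lambda>k. g (q k)"]) (use g in simp, rule that)
  define r where "r = q \<circ> p"
  have r: "strict_mono r" unfolding r_def by (rule strict_mono_o[OF q(1) p])
  have bg: "(\<lambda>l. b (r l) - g (r l)) \<longlonglongrightarrow> c"
    using LIMSEQ_subseq_LIMSEQ[OF q(2) p] by (simp add: r_def o_def)
  define h where "h t = f' (t + c)" for t
  have f_uc: "\<exists>d>0. \<forall>x y. dist x y < d \<longrightarrow> \<bar>f x - f y\<bar> \<le> e" if e: "e > 0" for e
  proof -
    obtain d where "d > 0" "\<forall>y x. dist x y < d \<longrightarrow> \<bar>f x - f y\<bar> < e"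
      using uc e unfolding BUC_iff by blast
    then show ?thesis by (intro exI[of _ d]) (simp add: less_imp_le)
  qed
  have f'_uc: "\<exists>d>0. \<forall>x y. dist x y < d \<longrightarrow> \<bar>f' x - f' y\<bar> \<le> e" if e: "e > 0" for e
  proof -
    obtain d where "d > 0" "\<forall>x y. dist x y < d \<longrightarrow> \<bar>f x - f y\<bar> \<le> e"
      using f_uc[OF e] by blast
    then have d: "d > 0" "\<And>x y. dist x y < d \<Longrightarrow> \<bar>f x - f y\<bar> \<le> e"
      by simp_all
    have "\<bar>f' x - f' y\<bar> \<le> e" if xy: "dist x y < d" for x y
    proof (rule tendsto_upperbound[OF tendsto_rabs[OF tendsto_diff[OF f'(1)[of x] f'(1)[of y]]]])
      have "\<bar>f (x + g (q (p l))) - f (y + g (q (p l)))\<bar> \<le> e" for l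
        by (rule d(2)) (use xy in \<open>simp add: dist_norm\<close>)
      then show "\<forall>\<^sub>F l in sequentially. \<bar>f (x + g (q (p l))) - f (y + g (q (p l)))\<bar> \<le> e"
        by (intro always_eventually allI)
    qed simp
    with d(1) show ?thesis by blast
  qed
  have shift: "(\<lambda>l. F (x l) - F (y l)) \<longlonglongrightarrow> 0"
    if F: "\<And>e. e > 0 \<Longrightarrow> \<exists>d>0. \<forall>x y. dist x y < d \<longrightarrow> \<bar>F x - F y\<bar> \<le> e"
      and xy: "(\<lambda>l. x l - y l) \<longlonglongrightarrow> 0" for F :: "real^'n \<Rightarrow> real" and x y :: "nat \<Rightarrow> real^'n"
  proof (rule tendstoI)
    fix e :: real assume e: "e > 0"
    obtain d where d: "d > 0" "\<And>x y. dist x y < d \<Longrightarrow> \<bar>F x - F y\<bar> \<le> e / 2"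
      using F[of "e / 2"] e by auto
    show "\<forall>\<^sub>F l in sequentially. dist (F (x l) - F (y l)) 0 < e"
      using tendstoD[OF xy d(1)]
    proof eventually_elim
      case (elim l)
      then have "\<bar>F (x l) - F (y l)\<bar> \<le> e / 2" by (intro d(2)) (simp add: dist_norm)
      with e show ?case by simp
    qed
  qed
  have lim1: "(\<lambda>l. f (t + b (r l))) \<longlonglongrightarrow> h t" for t
  proof -
    have "(\<lambda>l. (b (r l) - g (r l)) - c) \<longlonglongrightarrow> 0" using bg by (simp add: LIM_zero)
    moreover have "(b (r l) - g (r l)) - c = (t + b (r l)) - (t + c + g (r l))" for l by simp
    ultimately have "(\<lambda>l. (t + b (r l)) - (t + c + g (r l))) \<longlonglongrightarrow> 0" by simp
    then have "(\<lambda>l. f (t + b (r l)) - f (t + c + g (r l))) \<longlonglongrightarrow> 0"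
      by (rule shift[where F = "apply_bcontfun f", rotated]) (rule f_uc)
    from tendsto_add[OF this f'(1)[of "t + c"]] show ?thesis
      by (simp add: r_def h_def)
  qed
  have lim2: "(\<lambda>l. h (t - b (r l))) \<longlonglongrightarrow> f t" for t
  proof -
    have "(\<lambda>l. c - (b (r l) - g (r l))) \<longlonglongrightarrow> c - c" using bg by (intro tendsto_intros)
    moreover have "c - (b (r l) - g (r l)) = (t - b (r l) + c) - (t - g (r l))" for l by simp
    ultimately have "(\<lambda>l. (t - b (r l) + c) - (t - g (r l))) \<longlonglongrightarrow> 0" by simp
    then have "(\<lambda>l. f' (t - b (r l) + c) - f' (t - g (r l))) \<longlonglongrightarrow> 0"
      by (rule shift[where F = f', rotated]) (rule f'_uc)
    from tendsto_add[OF this f'(2)[of t]] show ?thesis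
      by (simp add: r_def h_def)
  qed
  have "uniform_limit K (\<lambda>l t. f (t + b (r l))) h sequentially" if "compact K" for K
  proof (rule equicontinuous_pointwise_imp_uniform_limit[OF _ lim1 that])
    fix e :: real assume "e > 0"
    then obtain d where "d > 0" "\<forall>x y. dist x y < d \<longrightarrow> \<bar>f x - f y\<bar> \<le> e" using f_uc by blast
    then show "\<exists>d>0. \<forall>l x y. dist x y < d \<longrightarrow> \<bar>f (x + b (r l)) - f (y + b (r l))\<bar> \<le> e"
      by (intro exI[of _ d]) (simp add: dist_norm)
  qed
  moreover have "uniform_limit K (\<lambda>l t. h (t - b (r l))) f sequentially" if "compact K" for K
  proof (rule equicontinuous_pointwise_imp_uniform_limit[OF _ lim2 that])
    fix e :: real assume "e > 0"
    then obtain d where "d > 0" "\<forall>x y. dist x y < d \<longrightarrow> \<bar>f' x - f' y\<bar> \<le> e" using f'_uc by blast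
    then show "\<exists>d>0. \<forall>l x y. dist x y < d \<longrightarrow> \<bar>h (x - b (r l)) - h (y - b (r l))\<bar> \<le> e"
      by (intro exI[of _ d]) (simp add: h_def dist_norm)
  qed
  ultimately show "\<exists>r g'. strict_mono r \<and> (\<forall>K. compact K \<longrightarrow>
      uniform_limit K (\<lambda>l t. f (t + b (r l))) g' sequentially \<and>
      uniform_limit K (\<lambda>l t. g' (t - b (r l))) f sequentially)"
    using r by (intro exI[of _ r] exI[of _ h] conjI allI impI)
qed simp

text \<open>Both limits in the definition pass through the convolution integral by dominated convergence; the
limit function \<open>f'\<close> need not be continuous, but it is measurable and has the same bound as \<open>f\<close>.\<close>
lemma conv_op_GAA:
  fixes f :: "(real^'n) \<Rightarrow>\<^sub>C real"
  assumes k: "integrable lborel k" and f: "apply_bcontfun f \<in> GAA G"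
  shows "apply_bcontfun (blinfun_apply (conv_op k) f) \<in> GAA G"
  unfolding GAA_def
proof safe
  fix b :: "nat \<Rightarrow> real^'n" assume b: "\<forall>k. b k \<in> G"
  obtain r f' where r: "strict_mono r"
    and f': "\<And>t. (\<lambda>l. f (t + b (r l))) \<longlonglongrightarrow> f' t" "\<And>t. (\<lambda>l. f' (t - b (r l))) \<longlonglongrightarrow> f t"
    using GAA_subsequence[OF f, of b] b by blast
  have [measurable]: "k \<in> borel_measurable borel"
    using borel_measurable_integrable[OF k] by simp
  have [measurable]: "f' \<in> borel_measurable borel"
    by (rule borel_measurable_LIMSEQ_real[OF f'(1)]) measurable
  have f'_le: "\<bar>f' t\<bar> \<le> norm f" for t
    by (rule tendsto_upperbound[OF tendsto_rabs[OF f'(1)]]) (simp_all add: abs_apply_bcontfun_le)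
  have w: "integrable lborel (\<lambda>y. \<bar>k y\<bar> * norm f)" using k by simp
  define h where "h x = (LINT y|lborel. k y * f' (x - y))" for x
  have "(\<lambda>l. blinfun_apply (conv_op k) f (t + b (r l))) \<longlonglongrightarrow> h t" for t
    unfolding conv_op_apply[OF k] h_def
  proof (rule integral_dominated_convergence[OF _ _ w])
    show "AE y in lborel. (\<lambda>l. k y * f (t + b (r l) - y)) \<longlonglongrightarrow> k y * f' (t - y)"
    proof (rule AE_I2)
      fix y
      show "(\<lambda>l. k y * f (t + b (r l) - y)) \<longlonglongrightarrow> k y * f' (t - y)"
        using tendsto_mult_left[OF f'(1)[of "t - y"], of "k y"] by (simp add: algebra_simps)
    qed
  qed (auto simp: abs_mult intro!: mult_left_mono abs_apply_bcontfun_le)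
  moreover have "(\<lambda>l. h (t - b (r l))) \<longlonglongrightarrow> blinfun_apply (conv_op k) f t" for t
    unfolding conv_op_apply[OF k] h_def
  proof (rule integral_dominated_convergence[OF _ _ w])
    show "AE y in lborel. (\<lambda>l. k y * f' (t - b (r l) - y)) \<longlonglongrightarrow> k y * f (t - y)"
    proof (rule AE_I2)
      fix y
      show "(\<lambda>l. k y * f' (t - b (r l) - y)) \<longlonglongrightarrow> k y * f (t - y)"
        using tendsto_mult_left[OF f'(2)[of "t - y"], of "k y"] by (simp add: algebra_simps)
    qed
  qed (auto simp: abs_mult intro!: mult_left_mono f'_le)
  ultimately show "\<exists>r g'. strict_mono r \<and>
      (\<forall>t. (\<lambda>l. blinfun_apply (conv_op k) f (t + b (r l))) \<longlonglongrightarrow> g' t) \<and>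
      (\<forall>t. (\<lambda>l. g' (t - b (r l))) \<longlonglongrightarrow> blinfun_apply (conv_op k) f t)"
    using r by blast
qed simp

section \<open>Almost automorphic solutions of the heat equation\<close>

theorem theorem6p3:
  fixes G :: "(real^'n) set"
    and Z :: "((real^'n) \<Rightarrow>\<^sub>C real) set"
    and f :: "(real^'n) \<Rightarrow>\<^sub>C real"
  assumes "G = integer_lattice \<or> closure G = UNIV"
    and "Z = UNIV \<or> Z = BUC"
    and "apply_bcontfun f \<in> GAA G"
    and "f \<in> laplacian_domain_closure Z"
  shows "\<exists>u. heat_solution Z f u \<and>
           (\<forall>v. heat_solution Z f v \<longrightarrow> (\<forall>t\<ge>0. \<forall>x. v t x = u t x)) \<and>
           (\<forall>t>0. u t \<in> KAA)"
proof (intro exI conjI allI impI)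
  show "heat_solution Z f (\<lambda>t. apply_bcontfun (heat_flow f t))"
    by (rule heat_solution_heat_flow[OF assms(2,4)])
next
  fix v :: "real \<Rightarrow> real^'n \<Rightarrow> real" and t :: real and x
  assume v: "heat_solution Z f v" and "t \<ge> 0"
  then consider "t = 0" | "t > 0" by linarith
  then show "v t x = heat_flow f t x"
  proof cases
    case 1
    then show ?thesis using v by (simp add: heat_solution_def heat_flow_def)
  next
    case 2
    then have "v t \<in> bcontfun" using v by (simp add: heat_solution_def)
    then have "v t = apply_bcontfun (Bcontfun (v t))" by (simp add: Bcontfun_inverse)
    also have "\<dots> = apply_bcontfun (heat_flow f t)"
      using heat_solution_eq_heat_semigroup[OF v assms(4) 2] 2 by (simp add: heat_flow_def)
    finally show ?thesis by simp
  qed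
next
  fix t :: real assume t: "t > 0"
  have "apply_bcontfun (blinfun_apply (heat_semigroup t) f) \<in> GAA G"
    unfolding heat_semigroup_def by (rule conv_op_GAA[OF integrable_heat_kernel[OF t] assms(3)])
  from GAA_BUC_imp_KAA[OF assms(1) this heat_semigroup_BUC[OF t]]
  show "apply_bcontfun (heat_flow f t) \<in> KAA"
    using t by (simp add: heat_flow_def)
qed

end
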